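(* Let $\Sigma$ be a finite alphabet and let $f:\Sigma^*\to\Sigma^*$ be a map computed by a Turing machine $\mathcal{M}=(\Sigma,Q,q_0,q_f,\delta)$. Then there exists a polygraphic program $\Pi$ having a $1$-cell $\mathtt{w}$, constructor $2$-cells $\mathtt{nil}:\ast\Rightarrow\mathtt{w}$ and $a:\mathtt{w}\Rightarrow\mathtt{w}$ for each $a\in\Sigma$, and a function $2$-cell $F:\mathtt{w}\Rightarrow\mathtt{w}$, such that, under the bijection $\underline{\cdot}:\Sigma^*\to[\![\mathtt{w}]\!]$ given by $\underline{e}=\mathtt{nil}$ and $\underline{aw}=\underline{w}\star_1 a$, one has $[\![F]\!](\underline{w})=\underline{f(w)}$ for every $w\in\Sigma^*$. In this sense polygraphic programs form a Turing-complete model of computation.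
   Context: A 3-polygraph $\Pi$ consists of sets of $0$-, $1$-, $2$-, $3$-cells and freely generates a strict $3$-category whose $k$-morphisms are called $k$-paths (a cell of dimension $j<k$ is regarded as a degenerate, i.e. identity, $k$-path). Each $2$-cell has a source and target which are $1$-paths, each $3$-cell a source and target which are parallel $2$-paths; $k$-paths compose by $\star_j$ ($0\le j<k$) subject to associativity, unit and exchange laws; $s_j,t_j$ are the $j$-source and $j$-target. An elementary $3$-path (containing exactly one $3$-cell) is a rewriting step from its $2$-source to its $2$-target; normal forms, termination, confluence refer to this rewriting on $2$-paths. A polygraphic program is a finite 3-polygraph with a single $0$-cell $\ast$ (so $1$-paths are words in the $1$-cells, $\ast$ being the empty word) whose $2$-cells split into: structure $2$-cells $\tau_{\xi,\zeta}:\xi\star_0\zeta\Rightarrow\zeta\star_0\xi$, $\delta_\xi:\xi\Rightarrow\xi\star_0\xi$, $\epsilon_\xi:\xi\Rightarrow\ast$ for all $1$-cells $\xi,\zeta$; constructor $2$-cells (of coarity $1$, i.e. target a single $1$-cell); and function $2$-cells. Its $3$-cells split into structure $3$-cells and computation $3$-cells. The structure $3$-cells are, for each constructor $c:u\Rightarrow\xi$ and each $1$-cell $\zeta$: $(c\star_0\zeta)\star_1\tau_{\xi,\zeta}\Rrightarrow\tau_{u,\zeta}\star_1(\zeta\star_0 c)$, $(\zeta\star_0 c)\star_1\tau_{\zeta,\xi}\Rrightarrow\tau_{\zeta,u}\star_1(c\star_0\zeta)$, $c\star_1\delta_\xi\Rrightarrow\delta_u\star_1(c\star_0 c)$, $c\star_1\epsilon_\xi\Rrightarrow\epsilon_u$,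 where $\tau_{u,\zeta}:u\zeta\Rightarrow\zeta u$, $\tau_{\zeta,u}:\zeta u\Rightarrow u\zeta$, $\delta_u:u\Rightarrow uu$, $\epsilon_u:u\Rightarrow\ast$ are the structure $2$-paths built inductively from the structure $2$-cells (identities when $u=\ast$). Each computation $3$-cell has $2$-source of the form $t\star_1 f$ with $t$ a $2$-path composed only of constructor $2$-cells and $f$ a function $2$-cell. A value of type $u$ ($u$ a $1$-path) is a $2$-path with source $\ast$ and target $u$ built only from constructor $2$-cells; $[\![u]\!]$ denotes their set. For a $2$-path $f:u\Rightarrow v$, $[\![f]\!]$ is the partial map $[\![u]\!]\to[\![v]\!]$ sending $t$ to $t'$ if $t\star_1 f$ has a unique normal form $t'$ and $t'$ is a value, undefined otherwise. A Turing machine $(\Sigma,Q,q_0,q_f,\delta)$ has alphabet $\Sigma$ extended by a blank $\sharp$ to $\overline\Sigma$, states $Q$ with initial $q_0$ and final $q_f$, and transition function $\delta:(Q\setminus\{q_f\})\times\overline\Sigma\to Q\times\overline\Sigma\times\{L,R\}$; configurations $(q,a,w_l,w_r)$ (state, read symbol, reversed left word, right word) evolve by the usual moves (moving off the end of a word reads $\sharp$). It computes $f:\Sigma^*\to\Sigma^*$ if for every $w\in\Sigma^*$, $(q_0,\sharp,e,w)$ reaches a configuration $(q_f,a,v,f(w))$. *)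

theory Defs
  imports Main "HOL-Library.FuncSet"
begin

section \<open>3-polygraphs with a single 0-cell\<close>

text \<open>
  With a single 0-cell, 1-paths are words over the 1-cells, with \<open>\<star>\<^sub>0\<close> on them being list
  append and the 0-cell being the empty word. The 2-paths are the elements of the free strict
  2-category: formal composites, well typed with respect to the boundaries of the 2-cells, modulo
  associativity, unit and exchange laws. The source and target of a 3-cell are 2-paths, given here
  by representatives.
\<close>

datatype ('x, gens: 'c) term2 =
    Ident "'x list"
  | Gen 'c
  | HComp "('x, 'c) term2" "('x, 'c) term2" (infixr "\<star>\<^sub>0" 75)
  | VComp "('x, 'c) term2" "('x, 'c) term2" (infixr "\<star>\<^sub>1" 70)

record ('x, 'c, 'k) polygraph3 =
  cells1 :: "'x set"
  cells2 :: "'c set"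
  src2 :: "'c \<Rightarrow> 'x list"
  tgt2 :: "'c \<Rightarrow> 'x list"
  cells3 :: "'k set"
  src3 :: "'k \<Rightarrow> ('x, 'c) term2"
  tgt3 :: "'k \<Rightarrow> ('x, 'c) term2"

primrec s\<^sub>1 :: "('x, 'c, 'k) polygraph3 \<Rightarrow> ('x, 'c) term2 \<Rightarrow> 'x list" where
  "s\<^sub>1 G (Ident u) = u"
| "s\<^sub>1 G (Gen c) = src2 G c"
| "s\<^sub>1 G (f \<star>\<^sub>0 g) = s\<^sub>1 G f @ s\<^sub>1 G g"
| "s\<^sub>1 G (f \<star>\<^sub>1 g) = s\<^sub>1 G f"

primrec t\<^sub>1 :: "('x, 'c, 'k) polygraph3 \<Rightarrow> ('x, 'c) term2 \<Rightarrow> 'x list" where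
  "t\<^sub>1 G (Ident u) = u"
| "t\<^sub>1 G (Gen c) = tgt2 G c"
| "t\<^sub>1 G (f \<star>\<^sub>0 g) = t\<^sub>1 G f @ t\<^sub>1 G g"
| "t\<^sub>1 G (f \<star>\<^sub>1 g) = t\<^sub>1 G g"

primrec wf2 :: "('x, 'c, 'k) polygraph3 \<Rightarrow> ('x, 'c) term2 \<Rightarrow> bool" where
  "wf2 G (Ident u) \<longleftrightarrow> u \<in> lists (cells1 G)"
| "wf2 G (Gen c) \<longleftrightarrow> c \<in> cells2 G"
| "wf2 G (f \<star>\<^sub>0 g) \<longleftrightarrow> wf2 G f \<and> wf2 G g"
| "wf2 G (f \<star>\<^sub>1 g) \<longleftrightarrow> wf2 G f \<and> wf2 G g \<and> t\<^sub>1 G f = s\<^sub>1 G g"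

inductive eq2 :: "('x, 'c, 'k) polygraph3 \<Rightarrow> ('x, 'c) term2 \<Rightarrow> ('x, 'c) term2 \<Rightarrow> bool"
  for G where
  eq2_refl: "wf2 G f \<Longrightarrow> eq2 G f f"
| eq2_sym: "eq2 G f g \<Longrightarrow> eq2 G g f"
| eq2_trans: "eq2 G f g \<Longrightarrow> eq2 G g h \<Longrightarrow> eq2 G f h"
| eq2_cong0: "eq2 G f f' \<Longrightarrow> eq2 G g g' \<Longrightarrow> eq2 G (f \<star>\<^sub>0 g) (f' \<star>\<^sub>0 g')"
| eq2_cong1: "eq2 G f f' \<Longrightarrow> eq2 G g g' \<Longrightarrow> t\<^sub>1 G f = s\<^sub>1 G g \<Longrightarrow> eq2 G (f \<star>\<^sub>1 g) (f' \<star>\<^sub>1 g')"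
| eq2_assoc0: "wf2 G ((f \<star>\<^sub>0 g) \<star>\<^sub>0 h) \<Longrightarrow> eq2 G ((f \<star>\<^sub>0 g) \<star>\<^sub>0 h) (f \<star>\<^sub>0 (g \<star>\<^sub>0 h))"
| eq2_assoc1: "wf2 G ((f \<star>\<^sub>1 g) \<star>\<^sub>1 h) \<Longrightarrow> eq2 G ((f \<star>\<^sub>1 g) \<star>\<^sub>1 h) (f \<star>\<^sub>1 (g \<star>\<^sub>1 h))"
| eq2_unit0_left: "wf2 G f \<Longrightarrow> eq2 G (Ident [] \<star>\<^sub>0 f) f"
| eq2_unit0_right: "wf2 G f \<Longrightarrow> eq2 G (f \<star>\<^sub>0 Ident []) f"
| eq2_unit1_left: "wf2 G f \<Longrightarrow> eq2 G (Ident (s\<^sub>1 G f) \<star>\<^sub>1 f) f"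
| eq2_unit1_right: "wf2 G f \<Longrightarrow> eq2 G (f \<star>\<^sub>1 Ident (t\<^sub>1 G f)) f"
| eq2_ident0: "wf2 G (Ident u) \<Longrightarrow> wf2 G (Ident v) \<Longrightarrow> eq2 G (Ident u \<star>\<^sub>0 Ident v) (Ident (u @ v))"
| eq2_exchange: "wf2 G ((f \<star>\<^sub>1 g) \<star>\<^sub>0 (h \<star>\<^sub>1 k)) \<Longrightarrow>
    eq2 G ((f \<star>\<^sub>1 g) \<star>\<^sub>0 (h \<star>\<^sub>1 k)) ((f \<star>\<^sub>0 h) \<star>\<^sub>1 (g \<star>\<^sub>0 k))"

definition polygraph3 :: "('x, 'c, 'k) polygraph3 \<Rightarrow> bool" where
  "polygraph3 G \<longleftrightarrow>
     (\<forall>c \<in> cells2 G. src2 G c \<in> lists (cells1 G) \<and> tgt2 G c \<in> lists (cells1 G)) \<and>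
     (\<forall>k \<in> cells3 G. wf2 G (src3 G k) \<and> wf2 G (tgt3 G k) \<and>
        s\<^sub>1 G (src3 G k) = s\<^sub>1 G (tgt3 G k) \<and> t\<^sub>1 G (src3 G k) = t\<^sub>1 G (tgt3 G k))"

definition finite_polygraph3 :: "('x, 'c, 'k) polygraph3 \<Rightarrow> bool" where
  "finite_polygraph3 G \<longleftrightarrow>
     polygraph3 G \<and> finite (cells1 G) \<and> finite (cells2 G) \<and> finite (cells3 G)"

type_synonym ('x, 'c) path2 = "('x, 'c) term2 set"

definition path2 :: "('x, 'c, 'k) polygraph3 \<Rightarrow> ('x, 'c) term2 \<Rightarrow> ('x, 'c) path2" where
  "path2 G f = {g. eq2 G f g}"

definition paths2 :: "('x, 'c, 'k) polygraph3 \<Rightarrow> ('x, 'c) path2 set" where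
  "paths2 G = path2 G ` {f. wf2 G f}"

definition src_path :: "('x, 'c, 'k) polygraph3 \<Rightarrow> ('x, 'c) path2 \<Rightarrow> 'x list" where
  "src_path G X = (THE u. \<exists>f \<in> X. u = s\<^sub>1 G f)"

definition tgt_path :: "('x, 'c, 'k) polygraph3 \<Rightarrow> ('x, 'c) path2 \<Rightarrow> 'x list" where
  "tgt_path G X = (THE u. \<exists>f \<in> X. u = t\<^sub>1 G f)"

definition comp1 :: "('x, 'c, 'k) polygraph3 \<Rightarrow> ('x, 'c) path2 \<Rightarrow> ('x, 'c) path2 \<Rightarrow> ('x, 'c) path2"
  where "comp1 G X Y = (\<Union>f \<in> X. \<Union>g \<in> Y. path2 G (f \<star>\<^sub>1 g))"

lemma eq2_wf_boundary:
  assumes "polygraph3 G" "eq2 G f g"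
  shows "wf2 G f \<and> wf2 G g \<and> s\<^sub>1 G f = s\<^sub>1 G g \<and> t\<^sub>1 G f = t\<^sub>1 G g"
proof -
  have bd: "s\<^sub>1 G h \<in> lists (cells1 G) \<and> t\<^sub>1 G h \<in> lists (cells1 G)" if "wf2 G h" for h
    using that assms(1) by (induction h) (auto simp: polygraph3_def)
  show ?thesis
    using assms(2) by (induction rule: eq2.induct) (use bd in auto)
qed

lemma path2_eq_iff:
  assumes "wf2 G f"
  shows "path2 G f = path2 G g \<longleftrightarrow> eq2 G f g"
proof
  assume "path2 G f = path2 G g"
  moreover have "f \<in> path2 G f"
    using assms by (simp add: path2_def eq2_refl)
  ultimately have "eq2 G g f"
    by (simp add: path2_def)
  then show "eq2 G f g"
    by (rule eq2_sym)
next
  assume "eq2 G f g"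
  then show "path2 G f = path2 G g"
    unfolding path2_def by (blast intro: eq2_sym eq2_trans)
qed

lemma src_path_path2:
  assumes "polygraph3 G" "wf2 G f"
  shows "src_path G (path2 G f) = s\<^sub>1 G f"
  unfolding src_path_def path2_def
  using assms by (auto intro!: the_equality eq2_refl dest: eq2_wf_boundary)

lemma tgt_path_path2:
  assumes "polygraph3 G" "wf2 G f"
  shows "tgt_path G (path2 G f) = t\<^sub>1 G f"
  unfolding tgt_path_def path2_def
  using assms by (auto intro!: the_equality eq2_refl dest: eq2_wf_boundary)

lemma comp1_path2:
  assumes "polygraph3 G" "wf2 G (f \<star>\<^sub>1 g)"
  shows "comp1 G (path2 G f) (path2 G g) = path2 G (f \<star>\<^sub>1 g)"
proof -
  have "path2 G (f' \<star>\<^sub>1 g') = path2 G (f \<star>\<^sub>1 g)" if "f' \<in> path2 G f" "g' \<in> path2 G g" for f' g'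
  proof -
    have "eq2 G (f \<star>\<^sub>1 g) (f' \<star>\<^sub>1 g')"
      using that assms(2) by (intro eq2_cong1) (simp_all add: path2_def)
    then show ?thesis
      using path2_eq_iff[OF assms(2)] by metis
  qed
  moreover have "f \<in> path2 G f" "g \<in> path2 G g"
    using assms(2) by (simp_all add: path2_def eq2_refl)
  ultimately show ?thesis
    unfolding comp1_def by blast
qed


section \<open>3-paths and rewriting of 2-paths\<close>

text \<open>
  Boundaries and the number of occurring 3-cells are invariant under the laws of strict
  3-categories, so rewriting steps can be read off from formal composites of 3-cells.
\<close>

datatype ('x, 'c, 'k) term3 =
    Gen3 'k
  | Ident3 "('x, 'c) term2"
  | Comp3_0 "('x, 'c, 'k) term3" "('x, 'c, 'k) term3"
  | Comp3_1 "('x, 'c, 'k) term3" "('x, 'c, 'k) term3"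
  | Comp3_2 "('x, 'c, 'k) term3" "('x, 'c, 'k) term3"

primrec s\<^sub>2 :: "('x, 'c, 'k) polygraph3 \<Rightarrow> ('x, 'c, 'k) term3 \<Rightarrow> ('x, 'c) term2" where
  "s\<^sub>2 G (Gen3 k) = src3 G k"
| "s\<^sub>2 G (Ident3 f) = f"
| "s\<^sub>2 G (Comp3_0 A B) = s\<^sub>2 G A \<star>\<^sub>0 s\<^sub>2 G B"
| "s\<^sub>2 G (Comp3_1 A B) = s\<^sub>2 G A \<star>\<^sub>1 s\<^sub>2 G B"
| "s\<^sub>2 G (Comp3_2 A B) = s\<^sub>2 G A"

primrec t\<^sub>2 :: "('x, 'c, 'k) polygraph3 \<Rightarrow> ('x, 'c, 'k) term3 \<Rightarrow> ('x, 'c) term2" where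
  "t\<^sub>2 G (Gen3 k) = tgt3 G k"
| "t\<^sub>2 G (Ident3 f) = f"
| "t\<^sub>2 G (Comp3_0 A B) = t\<^sub>2 G A \<star>\<^sub>0 t\<^sub>2 G B"
| "t\<^sub>2 G (Comp3_1 A B) = t\<^sub>2 G A \<star>\<^sub>1 t\<^sub>2 G B"
| "t\<^sub>2 G (Comp3_2 A B) = t\<^sub>2 G B"

primrec wf3 :: "('x, 'c, 'k) polygraph3 \<Rightarrow> ('x, 'c, 'k) term3 \<Rightarrow> bool" where
  "wf3 G (Gen3 k) \<longleftrightarrow> k \<in> cells3 G"
| "wf3 G (Ident3 f) \<longleftrightarrow> wf2 G f"
| "wf3 G (Comp3_0 A B) \<longleftrightarrow> wf3 G A \<and> wf3 G B"
| "wf3 G (Comp3_1 A B) \<longleftrightarrow> wf3 G A \<and> wf3 G B \<and> t\<^sub>1 G (s\<^sub>2 G A) = s\<^sub>1 G (s\<^sub>2 G B)"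
| "wf3 G (Comp3_2 A B) \<longleftrightarrow> wf3 G A \<and> wf3 G B \<and> eq2 G (t\<^sub>2 G A) (s\<^sub>2 G B)"

primrec count3 :: "('x, 'c, 'k) term3 \<Rightarrow> nat" where
  "count3 (Gen3 k) = 1"
| "count3 (Ident3 f) = 0"
| "count3 (Comp3_0 A B) = count3 A + count3 B"
| "count3 (Comp3_1 A B) = count3 A + count3 B"
| "count3 (Comp3_2 A B) = count3 A + count3 B"

definition rewrite_step :: "('x, 'c, 'k) polygraph3 \<Rightarrow> ('x, 'c) path2 \<Rightarrow> ('x, 'c) path2 \<Rightarrow> bool" where
  "rewrite_step G X Y \<longleftrightarrow>
     (\<exists>A. wf3 G A \<and> count3 A = 1 \<and> X = path2 G (s\<^sub>2 G A) \<and> Y = path2 G (t\<^sub>2 G A))"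

definition normal_form :: "('x, 'c, 'k) polygraph3 \<Rightarrow> ('x, 'c) path2 \<Rightarrow> bool" where
  "normal_form G X \<longleftrightarrow> X \<in> paths2 G \<and> (\<nexists>Y. rewrite_step G X Y)"

definition unique_normal_form ::
    "('x, 'c, 'k) polygraph3 \<Rightarrow> ('x, 'c) path2 \<Rightarrow> ('x, 'c) path2 \<Rightarrow> bool" where
  "unique_normal_form G X N \<longleftrightarrow> {N'. (rewrite_step G)\<^sup>*\<^sup>* X N' \<and> normal_form G N'} = {N}"


section \<open>Polygraphic programs\<close>

datatype ('x, 'c, 'f) cell2 =
    Tau 'x 'x
  | Delta 'x
  | Eps 'x
  | Con 'c
  | Fun 'f

datatype ('x, 'c, 'k) cell3 =
    ConTau 'c 'x
  | TauCon 'x 'c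
  | ConDelta 'c
  | ConEps 'c
  | Comput 'k

type_synonym ('x, 'c, 'f) prog_term = "('x, ('x, 'c, 'f) cell2) term2"
type_synonym ('x, 'c, 'f) prog_path = "('x, ('x, 'c, 'f) cell2) path2"

text \<open>
  The structure cells are determined by the 1-cells and the constructors, so that a program is
  given by the remaining data. A constructor has coarity 1, hence \<open>con_tgt\<close> is a single 1-cell.
\<close>

record ('x, 'c, 'f, 'k) program =
  sorts :: "'x set"
  con_cells :: "'c set"
  con_src :: "'c \<Rightarrow> 'x list"
  con_tgt :: "'c \<Rightarrow> 'x"
  fun_cells :: "'f set"
  fun_src :: "'f \<Rightarrow> 'x list"
  fun_tgt :: "'f \<Rightarrow> 'x list"
  computations :: "'k set"
  comp_src :: "'k \<Rightarrow> ('x, 'c, 'f) prog_term"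
  comp_tgt :: "'k \<Rightarrow> ('x, 'c, 'f) prog_term"

text \<open>\<open>tau_left u \<zeta> : u \<zeta> \<Rightarrow> \<zeta> u\<close> and \<open>tau_right \<zeta> u : \<zeta> u \<Rightarrow> u \<zeta>\<close>\<close>

fun tau_left :: "'x list \<Rightarrow> 'x \<Rightarrow> ('x, 'c, 'f) prog_term" where
  "tau_left [] \<zeta> = Ident [\<zeta>]"
| "tau_left (\<xi> # u) \<zeta> = (Ident [\<xi>] \<star>\<^sub>0 tau_left u \<zeta>) \<star>\<^sub>1 (Gen (Tau \<xi> \<zeta>) \<star>\<^sub>0 Ident u)"

fun tau_right :: "'x \<Rightarrow> 'x list \<Rightarrow> ('x, 'c, 'f) prog_term" where
  "tau_right \<zeta> [] = Ident [\<zeta>]"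
| "tau_right \<zeta> (\<xi> # u) = (Gen (Tau \<zeta> \<xi>) \<star>\<^sub>0 Ident u) \<star>\<^sub>1 (Ident [\<xi>] \<star>\<^sub>0 tau_right \<zeta> u)"

fun delta_word :: "'x list \<Rightarrow> ('x, 'c, 'f) prog_term" where
  "delta_word [] = Ident []"
| "delta_word (\<xi> # u) =
     (Gen (Delta \<xi>) \<star>\<^sub>0 delta_word u) \<star>\<^sub>1 (Ident [\<xi>] \<star>\<^sub>0 tau_right \<xi> u \<star>\<^sub>0 Ident u)"

fun eps_word :: "'x list \<Rightarrow> ('x, 'c, 'f) prog_term" where
  "eps_word [] = Ident []"
| "eps_word (\<xi> # u) = Gen (Eps \<xi>) \<star>\<^sub>0 eps_word u"

fun prog_src2 :: "('x, 'c, 'f, 'k) program \<Rightarrow> ('x, 'c, 'f) cell2 \<Rightarrow> 'x list" where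
  "prog_src2 P (Tau \<xi> \<zeta>) = [\<xi>, \<zeta>]"
| "prog_src2 P (Delta \<xi>) = [\<xi>]"
| "prog_src2 P (Eps \<xi>) = [\<xi>]"
| "prog_src2 P (Con c) = con_src P c"
| "prog_src2 P (Fun f) = fun_src P f"

fun prog_tgt2 :: "('x, 'c, 'f, 'k) program \<Rightarrow> ('x, 'c, 'f) cell2 \<Rightarrow> 'x list" where
  "prog_tgt2 P (Tau \<xi> \<zeta>) = [\<zeta>, \<xi>]"
| "prog_tgt2 P (Delta \<xi>) = [\<xi>, \<xi>]"
| "prog_tgt2 P (Eps \<xi>) = []"
| "prog_tgt2 P (Con c) = [con_tgt P c]"
| "prog_tgt2 P (Fun f) = fun_tgt P f"

fun prog_src3 :: "('x, 'c, 'f, 'k) program \<Rightarrow> ('x, 'c, 'k) cell3 \<Rightarrow> ('x, 'c, 'f) prog_term" where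
  "prog_src3 P (ConTau c \<zeta>) = (Gen (Con c) \<star>\<^sub>0 Ident [\<zeta>]) \<star>\<^sub>1 Gen (Tau (con_tgt P c) \<zeta>)"
| "prog_src3 P (TauCon \<zeta> c) = (Ident [\<zeta>] \<star>\<^sub>0 Gen (Con c)) \<star>\<^sub>1 Gen (Tau \<zeta> (con_tgt P c))"
| "prog_src3 P (ConDelta c) = Gen (Con c) \<star>\<^sub>1 Gen (Delta (con_tgt P c))"
| "prog_src3 P (ConEps c) = Gen (Con c) \<star>\<^sub>1 Gen (Eps (con_tgt P c))"
| "prog_src3 P (Comput k) = comp_src P k"

fun prog_tgt3 :: "('x, 'c, 'f, 'k) program \<Rightarrow> ('x, 'c, 'k) cell3 \<Rightarrow> ('x, 'c, 'f) prog_term" where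
  "prog_tgt3 P (ConTau c \<zeta>) = tau_left (con_src P c) \<zeta> \<star>\<^sub>1 (Ident [\<zeta>] \<star>\<^sub>0 Gen (Con c))"
| "prog_tgt3 P (TauCon \<zeta> c) = tau_right \<zeta> (con_src P c) \<star>\<^sub>1 (Gen (Con c) \<star>\<^sub>0 Ident [\<zeta>])"
| "prog_tgt3 P (ConDelta c) = delta_word (con_src P c) \<star>\<^sub>1 (Gen (Con c) \<star>\<^sub>0 Gen (Con c))"
| "prog_tgt3 P (ConEps c) = eps_word (con_src P c)"
| "prog_tgt3 P (Comput k) = comp_tgt P k"

definition polygraph_of ::
    "('x, 'c, 'f, 'k) program \<Rightarrow> ('x, ('x, 'c, 'f) cell2, ('x, 'c, 'k) cell3) polygraph3" where
  "polygraph_of P =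
     \<lparr> cells1 = sorts P,
       cells2 = {Tau \<xi> \<zeta> | \<xi> \<zeta>. \<xi> \<in> sorts P \<and> \<zeta> \<in> sorts P} \<union> Delta ` sorts P \<union> Eps ` sorts P
                  \<union> Con ` con_cells P \<union> Fun ` fun_cells P,
       src2 = prog_src2 P,
       tgt2 = prog_tgt2 P,
       cells3 = {ConTau c \<zeta> | c \<zeta>. c \<in> con_cells P \<and> \<zeta> \<in> sorts P}
                  \<union> {TauCon \<zeta> c | \<zeta> c. \<zeta> \<in> sorts P \<and> c \<in> con_cells P}
                  \<union> ConDelta ` con_cells P \<union> ConEps ` con_cells P
                  \<union> Comput ` computations P,
       src3 = prog_src3 P,
       tgt3 = prog_tgt3 P \<rparr>"

definition constructor_term ::
    "('x, 'c, 'f, 'k) program \<Rightarrow> ('x, 'c, 'f) prog_term \<Rightarrow> bool" where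
  "constructor_term P t \<longleftrightarrow> wf2 (polygraph_of P) t \<and> gens t \<subseteq> Con ` con_cells P"

definition polygraphic_program :: "('x, 'c, 'f, 'k) program \<Rightarrow> bool" where
  "polygraphic_program P \<longleftrightarrow>
     finite_polygraph3 (polygraph_of P) \<and>
     (\<forall>k \<in> computations P. \<exists>t. \<exists>f \<in> fun_cells P.
        constructor_term P t \<and> t\<^sub>1 (polygraph_of P) t = fun_src P f \<and>
        path2 (polygraph_of P) (comp_src P k) = path2 (polygraph_of P) (t \<star>\<^sub>1 Gen (Fun f)))"

definition cell_path :: "('x, 'c, 'f, 'k) program \<Rightarrow> ('x, 'c, 'f) cell2 \<Rightarrow> ('x, 'c, 'f) prog_path"
  where "cell_path P \<phi> = path2 (polygraph_of P) (Gen \<phi>)"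

definition vals :: "('x, 'c, 'f, 'k) program \<Rightarrow> 'x list \<Rightarrow> ('x, 'c, 'f) prog_path set" where
  "vals P u = path2 (polygraph_of P) `
     {t. constructor_term P t \<and> s\<^sub>1 (polygraph_of P) t = [] \<and> t\<^sub>1 (polygraph_of P) t = u}"

definition sem :: "('x, 'c, 'f, 'k) program \<Rightarrow> ('x, 'c, 'f) prog_path \<Rightarrow>
    ('x, 'c, 'f) prog_path \<rightharpoonup> ('x, 'c, 'f) prog_path" where
  "sem P X t =
     (let G = polygraph_of P in
      if t \<in> vals P (src_path G X) \<and>
         (\<exists>t' \<in> vals P (tgt_path G X). unique_normal_form G (comp1 G t X) t')
      then Some (THE t'. unique_normal_form G (comp1 G t X) t') else None)"

primrec word_val :: "('x, 'c, 'f, 'k) program \<Rightarrow> 'c \<Rightarrow> ('a \<Rightarrow> 'c) \<Rightarrow> 'a list \<Rightarrow>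
    ('x, 'c, 'f) prog_path" where
  "word_val P nil letter [] = cell_path P (Con nil)"
| "word_val P nil letter (a # w) =
     comp1 (polygraph_of P) (word_val P nil letter w) (cell_path P (Con (letter a)))"

lemma tau_left_boundary:
  "s\<^sub>1 (polygraph_of P) (tau_left u \<zeta>) = u @ [\<zeta>]" "t\<^sub>1 (polygraph_of P) (tau_left u \<zeta>) = \<zeta> # u"
  by (induction u) (auto simp: polygraph_of_def)

lemma tau_right_boundary:
  "s\<^sub>1 (polygraph_of P) (tau_right \<zeta> u) = \<zeta> # u" "t\<^sub>1 (polygraph_of P) (tau_right \<zeta> u) = u @ [\<zeta>]"
  by (induction u) (auto simp: polygraph_of_def)

lemma delta_word_boundary:
  "s\<^sub>1 (polygraph_of P) (delta_word u) = u" "t\<^sub>1 (polygraph_of P) (delta_word u) = u @ u"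
  by (induction u) (auto simp: tau_right_boundary, auto simp: polygraph_of_def)

lemma eps_word_boundary:
  "s\<^sub>1 (polygraph_of P) (eps_word u) = u" "t\<^sub>1 (polygraph_of P) (eps_word u) = []"
  by (induction u) (auto simp: polygraph_of_def)

lemma structure_term_wf2:
  assumes "u \<in> lists (sorts P)" "\<zeta> \<in> sorts P"
  shows "wf2 (polygraph_of P) (tau_left u \<zeta>)" "wf2 (polygraph_of P) (tau_right \<zeta> u)"
    "wf2 (polygraph_of P) (delta_word u)" "wf2 (polygraph_of P) (eps_word u)"
proof -
  have simps: "cells1 (polygraph_of P) = sorts P" "src2 (polygraph_of P) = prog_src2 P"
    "tgt2 (polygraph_of P) = prog_tgt2 P"
    "Tau \<xi> \<zeta> \<in> cells2 (polygraph_of P) \<longleftrightarrow> \<xi> \<in> sorts P \<and> \<zeta> \<in> sorts P"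
    "Delta \<xi> \<in> cells2 (polygraph_of P) \<longleftrightarrow> \<xi> \<in> sorts P"
    "Eps \<xi> \<in> cells2 (polygraph_of P) \<longleftrightarrow> \<xi> \<in> sorts P" for \<xi> \<zeta>
    by (auto simp: polygraph_of_def)
  show "wf2 (polygraph_of P) (tau_left u \<zeta>)"
    using assms by (induction u) (auto simp: simps tau_left_boundary)
  have right: "wf2 (polygraph_of P) (tau_right \<zeta> u)"
    if "u \<in> lists (sorts P)" "\<zeta> \<in> sorts P" for u \<zeta>
    using that by (induction u) (auto simp: simps tau_right_boundary)
  show "wf2 (polygraph_of P) (tau_right \<zeta> u)"
    by (rule right) (use assms in auto)
  show "wf2 (polygraph_of P) (delta_word u)"
    using assms(1)
    by (induction u) (auto simp: simps right tau_right_boundary delta_word_boundary)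
  show "wf2 (polygraph_of P) (eps_word u)"
    using assms(1) by (induction u) (auto simp: simps)
qed


section \<open>Turing machines\<close>

datatype dir = L | R

text \<open>
  The extended alphabet is rendered by the option type, \<open>None\<close> being the blank. The values of
  \<open>trans\<close> outside of \<open>(states M - {final M}) \<times> ext_alphabet M\<close> are irrelevant.
\<close>

record ('a, 'q) turing_machine =
  alphabet :: "'a set"
  states :: "'q set"
  init :: 'q
  final :: 'q
  trans :: "'q \<Rightarrow> 'a option \<Rightarrow> 'q \<times> 'a option \<times> dir"

definition ext_alphabet :: "('a, 'q) turing_machine \<Rightarrow> 'a option set" where
  "ext_alphabet M = insert None (Some ` alphabet M)"

definition turing_machine :: "('a, 'q) turing_machine \<Rightarrow> bool" where
  "turing_machine M \<longleftrightarrow>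
     finite (alphabet M) \<and> finite (states M) \<and> init M \<in> states M \<and> final M \<in> states M \<and>
     (\<forall>q \<in> states M - {final M}. \<forall>a \<in> ext_alphabet M.
        trans M q a \<in> states M \<times> ext_alphabet M \<times> UNIV)"

type_synonym ('a, 'q) config = "'q \<times> 'a option \<times> 'a option list \<times> 'a option list"

inductive tm_step :: "('a, 'q) turing_machine \<Rightarrow> ('a, 'q) config \<Rightarrow> ('a, 'q) config \<Rightarrow> bool"
  for M where
  "q \<noteq> final M \<Longrightarrow> trans M q a = (q', c, L) \<Longrightarrow> tm_step M (q, a, [], r) (q', None, [], c # r)"
| "q \<noteq> final M \<Longrightarrow> trans M q a = (q', c, L) \<Longrightarrow> tm_step M (q, a, b # l, r) (q', b, l, c # r)"
| "q \<noteq> final M \<Longrightarrow> trans M q a = (q', c, R) \<Longrightarrow> tm_step M (q, a, l, []) (q', None, c # l, [])"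
| "q \<noteq> final M \<Longrightarrow> trans M q a = (q', c, R) \<Longrightarrow> tm_step M (q, a, l, b # r) (q', b, c # l, r)"

definition tm_computes :: "('a, 'q) turing_machine \<Rightarrow> ('a list \<Rightarrow> 'a list) \<Rightarrow> bool" where
  "tm_computes M f \<longleftrightarrow>
     (\<forall>w \<in> lists (alphabet M). \<exists>a v.
        (tm_step M)\<^sup>*\<^sup>* (init M, None, [], map Some w) (final M, a, v, map Some (f w)))"

end

theory Submission
  imports Defs
begin

text \<open>
  A configuration of the machine is written as a 2-path that is a single strand: constructors
  encoding the right part of the tape, followed by function 2-cells encoding the left part, all of
  arity at most 1 and coarity 1. Rewriting of such 2-paths is string rewriting, in which the first
  function 2-cell meets the constructors on its left. Since every left-hand side consists of at
  least one constructor and exactly one function 2-cell, at most one rule applies, at a single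
  position; structure 3-cells never apply. Hence the normal form of the input strand is the result
  of the unique run. Blanks are confined to a second sort, so that the values of the sort of words
  are exactly the words over the alphabet.
\<close>

text \<open>The obstacle is that a 2-path is a class of formal composites and that a rewriting step
  may be witnessed by a formal 3-path of any shape, so redexes cannot be read off the syntax. The
  remedy is an invariant: evaluated on tuples of strings, a step in any context becomes one
  rewriting of one string. Two facts make this work. The laws preserve the set of 2-cells that
  occur, while the source of each structure 3-cell contains a structure 2-cell. And a 2-cell of
  arity at most 1 and coarity 1 neither merges nor copies strings. Uniqueness of the normal form
  rests on determinism along the run of the given input, which is finite because the machine halts
  on it; from other strings the program may loop.\<close>

declare eq2_trans [trans]

section \<open>Strands\<close>

text \<open>The leading identity gives even the empty string a source, and nesting to the left makes
  appending a 2-cell a plain unfolding.\<close>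

definition strand :: "'x list \<Rightarrow> 'c list \<Rightarrow> ('x, 'c) term2" where
  "strand u s = foldl (\<lambda>t c. t \<star>\<^sub>1 Gen c) (Ident u) s"

lemma strand_Nil [simp]: "strand u [] = Ident u"
  and strand_snoc [simp]: "strand u (s @ [c]) = strand u s \<star>\<^sub>1 Gen c"
  and strand_singleton [simp]: "strand u [c] = Ident u \<star>\<^sub>1 Gen c"
  by (simp_all add: strand_def)

lemma gens_strand [simp]: "gens (strand u s) = set s"
  by (induction s rule: rev_induct) auto

lemma s1_strand [simp]: "s\<^sub>1 G (strand u s) = u"
  by (induction s rule: rev_induct) auto

text \<open>Composability of a string of 2-cells. Source and target are parameters rather than taken
  from a polygraph, so that typing can be checked on the symbolic names of the machine and carried
  over to their numeric codes.\<close>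

primrec chain :: "('c \<Rightarrow> 'x list) \<Rightarrow> ('c \<Rightarrow> 'x list) \<Rightarrow> 'x list \<Rightarrow> 'c list \<Rightarrow> 'x list \<Rightarrow> bool" where
  "chain src tgt u [] v \<longleftrightarrow> u = v"
| "chain src tgt u (c # s) v \<longleftrightarrow> src c = u \<and> chain src tgt (tgt c) s v"

lemma chain_append:
  "chain src tgt u (s @ s') v \<longleftrightarrow> (\<exists>m. chain src tgt u s m \<and> chain src tgt m s' v)"
  by (induction s arbitrary: u) auto

lemma chain_map:
  assumes "\<And>c. c \<in> set s \<Longrightarrow> src (e c) = src' c \<and> tgt (e c) = tgt' c"
  shows "chain src tgt u (map e s) v \<longleftrightarrow> chain src' tgt' u s v"
  using assms by (induction s arbitrary: u) auto

lemma wf2_strand: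
  "wf2 G (strand u s) \<and> t\<^sub>1 G (strand u s) = v \<longleftrightarrow>
     u \<in> lists (cells1 G) \<and> set s \<subseteq> cells2 G \<and> chain (src2 G) (tgt2 G) u s v"
  by (induction s arbitrary: v rule: rev_induct) (auto simp: chain_append)

lemma wf2_boundary:
  assumes "polygraph3 G" "wf2 G f"
  shows "s\<^sub>1 G f \<in> lists (cells1 G)" "t\<^sub>1 G f \<in> lists (cells1 G)"
  using assms(2) assms(1) by (induction f) (auto simp: polygraph3_def)

text \<open>Reassociation, used to isolate a redex inside a string from its context.\<close>

lemma strand_append:
  assumes "polygraph3 G" "wf2 G (strand u (s @ s'))"
  shows "eq2 G (strand u (s @ s')) (strand u s \<star>\<^sub>1 strand (t\<^sub>1 G (strand u s)) s')"
  using assms(2)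
proof (induction s' rule: rev_induct)
  case Nil
  then show ?case
    by (simp add: eq2_sym eq2_unit1_right)
next
  case (snoc c s')
  let ?m = "t\<^sub>1 G (strand u s)"
  have wf: "wf2 G (strand u (s @ s') \<star>\<^sub>1 Gen c)"
    using snoc.prems by (simp flip: append_assoc)
  have IH: "eq2 G (strand u (s @ s')) (strand u s \<star>\<^sub>1 strand ?m s')"
    using snoc.IH wf by simp
  note bd = eq2_wf_boundary[OF assms(1) IH]
  have "eq2 G (strand u (s @ s') \<star>\<^sub>1 Gen c) ((strand u s \<star>\<^sub>1 strand ?m s') \<star>\<^sub>1 Gen c)"
    using IH wf by (auto intro!: eq2_cong1 eq2_refl)
  also have "eq2 G \<dots> (strand u s \<star>\<^sub>1 (strand ?m s' \<star>\<^sub>1 Gen c))"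
    using bd wf by (intro eq2_assoc1) auto
  finally show ?case
    by (simp flip: append_assoc)
qed

text \<open>The laws move 2-cells and insert or remove identities only. This is what later keeps
  structure 2-cells, and with them structure 3-cells, out of every representative of a
  strand.\<close>

lemma eq2_gens: "eq2 G f g \<Longrightarrow> gens f = gens g"
  by (induction rule: eq2.induct) auto


section \<open>Flows\<close>

text \<open>
  A 2-path acts on tuples of strings by letting each 2-cell append its name to its input. This is
  an invariant of the free 2-category, and a complete one for the 2-paths without source whose
  2-cells have arity at most 1 and coarity 1.
\<close>

primrec flow :: "('x, 'c, 'k) polygraph3 \<Rightarrow> ('x, 'c) term2 \<Rightarrow> 'c list list \<Rightarrow> 'c list list" where
  "flow G (Ident u) xs = xs"
| "flow G (Gen c) xs = replicate (length (tgt2 G c)) (concat xs @ [c])"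
| "flow G (f \<star>\<^sub>0 g) xs =
     flow G f (take (length (s\<^sub>1 G f)) xs) @ flow G g (drop (length (s\<^sub>1 G f)) xs)"
| "flow G (f \<star>\<^sub>1 g) xs = flow G g (flow G f xs)"

lemma length_flow:
  "wf2 G f \<Longrightarrow> length xs = length (s\<^sub>1 G f) \<Longrightarrow> length (flow G f xs) = length (t\<^sub>1 G f)"
  by (induction f arbitrary: xs) auto

text \<open>The length condition is essential: \<open>flow\<close> cuts its input by the length of a
  source, and the exchange law holds for it only if each factor receives and returns as many strings
  as its boundary says.\<close>

lemma eq2_flow:
  assumes "polygraph3 G" "eq2 G f g" "length xs = length (s\<^sub>1 G f)"
  shows "flow G f xs = flow G g xs"
  using assms(2,3)
proof (induction arbitrary: xs rule: eq2.induct)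
  case (eq2_sym f g)
  then show ?case
    using eq2_wf_boundary[OF assms(1) eq2_sym.hyps] by simp
next
  case (eq2_trans f g h)
  then show ?case
    using eq2_wf_boundary[OF assms(1) eq2_trans.hyps(1)] by simp
next
  case (eq2_cong0 f f' g g')
  then show ?case
    using eq2_wf_boundary[OF assms(1) eq2_cong0.hyps(1)] by simp
next
  case (eq2_cong1 f f' g g')
  then show ?case
    using eq2_wf_boundary[OF assms(1) eq2_cong1.hyps(1)] by (simp add: length_flow)
next
  case (eq2_assoc0 f g h)
  then show ?case
    by (simp add: take_drop add.commute)
next
  case (eq2_exchange f g h k)
  then show ?case
    by (simp add: length_flow)
qed (simp_all add: length_flow)

text \<open>Concatenation treats the empty string, which leaves all entries of \<open>xs\<close>
  separate, in the same way as the others, whose first 2-cell merges them.\<close>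

lemma concat_flow_strand:
  assumes "\<And>c. c \<in> set s \<Longrightarrow> length (tgt2 G c) = 1"
  shows "concat (flow G (strand u s) xs) = concat xs @ s"
  using assms by (induction s rule: rev_induct) auto

lemma flow_strand:
  assumes "wf2 G (strand u s)" "\<And>c. c \<in> set s \<Longrightarrow> length (tgt2 G c) = 1"
    and "length xs = length u" "length (t\<^sub>1 G (strand u s)) = 1"
  shows "flow G (strand u s) xs = [concat xs @ s]"
proof -
  have "length (flow G (strand u s) xs) = 1"
    using assms length_flow[OF assms(1)] by simp
  then obtain y where "flow G (strand u s) xs = [y]"
    by (auto simp: length_Suc_conv)
  then show ?thesis
    using concat_flow_strand[of s G u xs] assms(2) by simp
qed

section \<open>Tuples of closed strings as normal forms of linear 2-paths\<close>

primrec strands :: "'c list list \<Rightarrow> ('x, 'c) term2" where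
  "strands [] = Ident []"
| "strands (s # ss) = strand [] s \<star>\<^sub>0 strands ss"

text \<open>Coarity 1 makes the entries of the tuple correspond to the letters of the target word,
  so that a tuple can be cut wherever the word is cut.\<close>

definition closed_strings :: "('x, 'c, 'k) polygraph3 \<Rightarrow> 'c list list \<Rightarrow> bool" where
  "closed_strings G ss \<longleftrightarrow>
     (\<forall>s \<in> set ss. wf2 G (strand [] s) \<and> length (t\<^sub>1 G (strand [] s)) = 1)"

lemma closed_strings_simps [simp]:
  "closed_strings G []"
  "closed_strings G (s # ss) \<longleftrightarrow>
     wf2 G (strand [] s) \<and> length (t\<^sub>1 G (strand [] s)) = 1 \<and> closed_strings G ss"
  "closed_strings G (ss @ ss') \<longleftrightarrow> closed_strings G ss \<and> closed_strings G ss'"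
  by (auto simp: closed_strings_def)

lemma s1_strands [simp]: "s\<^sub>1 G (strands ss) = []"
  by (induction ss) auto

lemma wf2_strands: "closed_strings G ss \<Longrightarrow> wf2 G (strands ss)"
  by (induction ss) auto

lemma length_t1_strands: "closed_strings G ss \<Longrightarrow> length (t\<^sub>1 G (strands ss)) = length ss"
  by (induction ss) auto

lemma t1_strands_append: "t\<^sub>1 G (strands (ss @ ss')) = t\<^sub>1 G (strands ss) @ t\<^sub>1 G (strands ss')"
  by (induction ss) auto

lemma strands_append:
  assumes "closed_strings G ss" "closed_strings G ss'"
  shows "eq2 G (strands (ss @ ss')) (strands ss \<star>\<^sub>0 strands ss')"
  using assms
proof (induction ss)
  case Nil
  then show ?case
    by (simp add: eq2_sym eq2_unit0_left wf2_strands)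
next
  case (Cons s ss)
  have "eq2 G (strands ((s # ss) @ ss')) (strand [] s \<star>\<^sub>0 (strands ss \<star>\<^sub>0 strands ss'))"
    using Cons by (auto intro!: eq2_cong0 eq2_refl)
  also have "eq2 G \<dots> (strands (s # ss) \<star>\<^sub>0 strands ss')"
    using Cons.prems by (auto intro!: eq2_sym[OF eq2_assoc0] simp: wf2_strands)
  finally show ?case .
qed

text \<open>Completeness of the invariant: a tuple of strings is pushed through \<open>t\<close>
  cell by cell, exchange splitting it at each horizontal composite. The tuple is arbitrary because
  the second factor of a vertical composite receives the output of the first.\<close>

lemma strands_flow:
  assumes "polygraph3 G" "wf2 G t"
    and "\<And>c. c \<in> gens t \<Longrightarrow> length (src2 G c) \<le> 1 \<and> length (tgt2 G c) = 1"
    and "closed_strings G ss" "t\<^sub>1 G (strands ss) = s\<^sub>1 G t"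
  shows "eq2 G (strands ss \<star>\<^sub>1 t) (strands (flow G t ss)) \<and> closed_strings G (flow G t ss)"
  using assms(2-)
proof (induction t arbitrary: ss)
  case (Ident u)
  then show ?case
    using eq2_unit1_right[OF wf2_strands, of G ss] by simp
next
  case (Gen c)
  have len: "length ss = length (src2 G c)"
    using Gen.prems length_t1_strands[of G ss] by simp
  from Gen.prems have lin: "length (src2 G c) \<le> 1" "length (tgt2 G c) = 1"
    by auto
  show ?case
  proof (cases ss)
    \<comment> \<open>A 2-cell without source opens a new string, which consists of its own
      name.\<close>
    case Nil
    then show ?thesis
      using Gen.prems lin by (auto intro!: eq2_sym[OF eq2_unit0_right])
  next
    case (Cons s ss')
    with len lin have ss: "ss = [s]"
      by (cases ss') auto
    have wf: "wf2 G (strand [] (s @ [c]))"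
      using Gen.prems ss by simp
    have "eq2 G (strands ss \<star>\<^sub>1 Gen c) (strand [] (s @ [c]))"
      using Gen.prems ss by (auto intro!: eq2_cong1 eq2_unit0_right eq2_refl)
    also have "eq2 G \<dots> (strands [s @ [c]])"
      using wf by (auto intro!: eq2_sym[OF eq2_unit0_right] simp del: strand_snoc)
    finally show ?thesis
      using ss lin wf by simp
  qed
next
  case (HComp f g)
  define ss1 ss2 where "ss1 = take (length (s\<^sub>1 G f)) ss" and "ss2 = drop (length (s\<^sub>1 G f)) ss"
  have ss: "ss = ss1 @ ss2"
    by (simp add: ss1_def ss2_def)
  have cl: "closed_strings G ss1" "closed_strings G ss2"
    using HComp.prems(3) unfolding ss by simp_all
  have "length ss = length (s\<^sub>1 G f) + length (s\<^sub>1 G g)"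
    using HComp.prems length_t1_strands[of G ss] by simp
  \<comment> \<open>The equality of lengths lets the equation between concatenated boundaries be
    split into its two components.\<close>
  then have "length (t\<^sub>1 G (strands ss1)) = length (s\<^sub>1 G f)"
    using cl by (simp add: length_t1_strands ss1_def)
  then have bd: "t\<^sub>1 G (strands ss1) = s\<^sub>1 G f" "t\<^sub>1 G (strands ss2) = s\<^sub>1 G g"
    using HComp.prems(4) by (simp_all add: ss t1_strands_append)
  have IH1: "eq2 G (strands ss1 \<star>\<^sub>1 f) (strands (flow G f ss1))" "closed_strings G (flow G f ss1)"
    using HComp.IH(1)[of ss1] HComp.prems cl bd by auto
  have IH2: "eq2 G (strands ss2 \<star>\<^sub>1 g) (strands (flow G g ss2))" "closed_strings G (flow G g ss2)"
    using HComp.IH(2)[of ss2] HComp.prems cl bd by auto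
  have "eq2 G (strands ss \<star>\<^sub>1 (f \<star>\<^sub>0 g)) ((strands ss1 \<star>\<^sub>0 strands ss2) \<star>\<^sub>1 (f \<star>\<^sub>0 g))"
    using HComp.prems cl by (auto intro!: eq2_cong1 eq2_refl simp: strands_append ss)
  also have "eq2 G \<dots> ((strands ss1 \<star>\<^sub>1 f) \<star>\<^sub>0 (strands ss2 \<star>\<^sub>1 g))"
    using HComp.prems cl bd by (auto intro!: eq2_sym[OF eq2_exchange] simp: wf2_strands)
  also have "eq2 G \<dots> (strands (flow G f ss1) \<star>\<^sub>0 strands (flow G g ss2))"
    using IH1 IH2 by (auto intro: eq2_cong0)
  also have "eq2 G \<dots> (strands (flow G f ss1 @ flow G g ss2))"
    using IH1 IH2 by (auto intro: eq2_sym[OF strands_append])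
  finally show ?case
    using IH1 IH2 by (simp add: ss1_def ss2_def)
next
  case (VComp f g)
  have IH1: "eq2 G (strands ss \<star>\<^sub>1 f) (strands (flow G f ss))" "closed_strings G (flow G f ss)"
    using VComp.IH(1)[of ss] VComp.prems by auto
  have bd: "t\<^sub>1 G (strands (flow G f ss)) = s\<^sub>1 G g"
    using eq2_wf_boundary[OF assms(1) IH1(1)] VComp.prems by simp
  have IH2: "eq2 G (strands (flow G f ss) \<star>\<^sub>1 g) (strands (flow G g (flow G f ss)))"
    "closed_strings G (flow G g (flow G f ss))"
    using VComp.IH(2)[of "flow G f ss"] VComp.prems IH1 bd by auto
  have "eq2 G (strands ss \<star>\<^sub>1 (f \<star>\<^sub>1 g)) ((strands ss \<star>\<^sub>1 f) \<star>\<^sub>1 g)"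
    using VComp.prems by (auto intro!: eq2_sym[OF eq2_assoc1] simp: wf2_strands)
  also have "eq2 G \<dots> (strands (flow G f ss) \<star>\<^sub>1 g)"
    using IH1 VComp.prems by (auto intro!: eq2_cong1 eq2_refl)
  also note IH2(1)
  finally show ?case
    using IH2 by simp
qed

text \<open>\<open>strands_flow\<close> for the empty tuple: a term with empty source computes its
  own strand.\<close>

lemma closed_linear_term:
  assumes "polygraph3 G" "wf2 G t" "s\<^sub>1 G t = []" "length (t\<^sub>1 G t) = 1"
    and "\<And>c. c \<in> gens t \<Longrightarrow> length (src2 G c) \<le> 1 \<and> length (tgt2 G c) = 1"
  obtains s where "flow G t [] = [s]" "eq2 G t (strand [] s)"
proof -
  have flow: "eq2 G (Ident [] \<star>\<^sub>1 t) (strands (flow G t []))"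
    using strands_flow[OF assms(1,2,5), of "[]"] assms(3) by auto
  have "length (flow G t []) = 1"
    using length_flow[OF assms(2), of "[]"] assms by simp
  then obtain s where s: "flow G t [] = [s]"
    by (auto simp: length_Suc_conv)
  have wf: "wf2 G (strand [] s)"
    using eq2_wf_boundary[OF assms(1) flow] s by simp
  have "eq2 G t (Ident [] \<star>\<^sub>1 t)"
    using eq2_sym[OF eq2_unit1_left[OF assms(2)]] assms(3) by simp
  also note flow
  also have "eq2 G (strands (flow G t [])) (strand [] s)"
    using wf by (auto simp: s intro: eq2_unit0_right)
  finally show ?thesis
    using that s by blast
qed


section \<open>String rewriting inside a 3-polygraph\<close>

inductive srewrite :: "('c list \<times> 'c list) set \<Rightarrow> 'c list \<Rightarrow> 'c list \<Rightarrow> bool" for Rs where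
  "(l, r) \<in> Rs \<Longrightarrow> srewrite Rs (p @ l @ q) (p @ r @ q)"

text \<open>Intermediate terms of a composite carry several strings side by side; a single 3-cell
  acts on exactly one of them.\<close>

inductive step_at :: "('s \<Rightarrow> 's \<Rightarrow> bool) \<Rightarrow> 's list \<Rightarrow> 's list \<Rightarrow> bool" for Q where
  "Q x y \<Longrightarrow> step_at Q (us @ x # vs) (us @ y # vs)"

lemma srewrite_append:
  assumes "srewrite Rs x y"
  shows "srewrite Rs (x @ z) (y @ z)"
  using assms
proof cases
  case (1 l r p q)
  then show ?thesis
    using srewrite.intros[of l r Rs p "q @ z"] by simp
qed

lemma step_at_append1: "step_at Q xs ys \<Longrightarrow> step_at Q (xs @ zs) (ys @ zs)"
  by (force elim!: step_at.cases intro: step_at.intros)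

lemma step_at_append2: "step_at Q xs ys \<Longrightarrow> step_at Q (zs @ xs) (zs @ ys)"
  by (force elim!: step_at.cases intro: step_at.intros simp flip: append_assoc)

lemma step_at_length: "step_at Q xs ys \<Longrightarrow> length ys = length xs"
  by (auto elim: step_at.cases)

lemma step_at_singleton: "step_at Q [x] ys \<Longrightarrow> \<exists>y. ys = [y] \<and> Q x y"
  by (auto elim!: step_at.cases simp: Cons_eq_append_conv)

lemma step_at_take_drop:
  assumes "step_at Q xs ys"
  shows "(step_at Q (take n xs) (take n ys) \<and> drop n xs = drop n ys) \<or>
         (take n xs = take n ys \<and> step_at Q (drop n xs) (drop n ys))"
  using assms
proof cases
  case (1 x y us vs)
  show ?thesis
  proof (cases "n \<le> length us")
    case True
    then show ?thesis
      using 1 step_at.intros[of Q x y] by simp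
  next
    case False
    then obtain m where "n - length us = Suc m"
      by (metis Suc_diff_le Suc_leI diff_Suc_Suc not_le)
    then show ?thesis
      using 1 False step_at.intros[of Q x y] by simp
  qed
qed

text \<open>Linearity of contexts: coarity 1 does not duplicate the changed string, and arity at
  most 1 does not mix it with others, so one rewriting stays one rewriting.\<close>

lemma flow_step_at:
  assumes "wf2 G f" "\<And>c. c \<in> gens f \<Longrightarrow> length (src2 G c) \<le> 1 \<and> length (tgt2 G c) = 1"
    and "step_at (srewrite Rs) xs ys" "length xs = length (s\<^sub>1 G f)"
  shows "step_at (srewrite Rs) (flow G f xs) (flow G f ys)"
  using assms
proof (induction f arbitrary: xs ys)
  case (Gen c)
  from Gen.prems(3) obtain us x y vs where xy: "xs = us @ x # vs" "ys = us @ y # vs" "srewrite Rs x y"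
    by (auto elim: step_at.cases)
  have "Suc (length us + length vs) \<le> 1"
    using Gen.prems(2,4) xy(1) by fastforce
  then have "us = []" "vs = []"
    by simp_all
  then show ?case
    using xy Gen.prems(2) step_at.intros[of "srewrite Rs" "x @ [c]" "y @ [c]" "[]" "[]"]
      srewrite_append[OF xy(3), of "[c]"]
    by simp
next
  case (HComp f g)
  from step_at_take_drop[OF HComp.prems(3), of "length (s\<^sub>1 G f)"] show ?case
    using HComp.prems HComp.IH
    by (auto intro!: step_at_append1 step_at_append2 simp: step_at_length)
next
  case (VComp f g)
  then show ?case
    by (simp add: length_flow)
qed simp

lemma wf3_boundary:
  assumes "polygraph3 G" "wf3 G A"
  shows "wf2 G (s\<^sub>2 G A) \<and> wf2 G (t\<^sub>2 G A) \<and> s\<^sub>1 G (s\<^sub>2 G A) = s\<^sub>1 G (t\<^sub>2 G A) \<and>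
    t\<^sub>1 G (s\<^sub>2 G A) = t\<^sub>1 G (t\<^sub>2 G A)"
  using assms(2)
proof (induction A)
  case (Gen3 k)
  then show ?case
    using assms(1) by (simp add: polygraph3_def)
next
  case (Comp3_2 A B)
  then show ?case
    using eq2_wf_boundary[OF assms(1), of "t\<^sub>2 G A" "s\<^sub>2 G B"] by simp
qed auto

lemma wf3_identity:
  assumes "polygraph3 G" "wf3 G A" "count3 A = 0"
  shows "eq2 G (s\<^sub>2 G A) (t\<^sub>2 G A)"
  using assms(2,3)
proof (induction A)
  case (Comp3_2 A B)
  then show ?case
    by (auto intro: eq2_trans)
qed (auto intro: eq2_refl eq2_cong0 eq2_cong1)

text \<open>\<open>S\<close> holds the 2-cells allowed in strands. The assumption
  \<open>cells\<close> speaks only of 3-cells whose source stays inside \<open>S\<close>, which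
  exempts the structure 3-cells; \<open>rules\<close> is the converse. A left-hand side is nonempty,
  so the source of its strand is that of its first 2-cell.\<close>

locale string_polygraph =
  fixes G :: "('x, 'c, 'k) polygraph3" and S :: "'c set" and Rs :: "('c list \<times> 'c list) set"
  assumes polygraph: "polygraph3 G"
    and linear: "c \<in> S \<Longrightarrow> length (src2 G c) \<le> 1 \<and> length (tgt2 G c) = 1"
    and cells: "k \<in> cells3 G \<Longrightarrow> gens (src3 G k) \<subseteq> S \<Longrightarrow>
      \<exists>(l, r) \<in> Rs. src3 G k = strand (src2 G (hd l)) l \<and> tgt3 G k = strand (src2 G (hd l)) r"
    and rules: "(l, r) \<in> Rs \<Longrightarrow> l \<noteq> [] \<and> set l \<subseteq> S \<and> set r \<subseteq> S \<and>
      (\<exists>k \<in> cells3 G. src3 G k = strand (src2 G (hd l)) l \<and> tgt3 G k = strand (src2 G (hd l)) r)"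
begin

lemma t1_strand_linear:
  assumes "wf2 G (strand u l)" "set l \<subseteq> S" "l \<noteq> []"
  shows "length (t\<^sub>1 G (strand u l)) = 1"
  using assms linear by (cases l rule: rev_cases) auto

text \<open>Of two composed 3-paths exactly one contains the 3-cell; the other has source and target
  equal modulo the laws, hence the same flow. The claim on \<open>gens\<close> ensures that the
  result of a step is again a term over \<open>S\<close>.\<close>

lemma step_flow:
  assumes "wf3 G A" "count3 A = 1" "gens (s\<^sub>2 G A) \<subseteq> S" "length xs = length (s\<^sub>1 G (s\<^sub>2 G A))"
  shows "step_at (srewrite Rs) (flow G (s\<^sub>2 G A) xs) (flow G (t\<^sub>2 G A) xs) \<and> gens (t\<^sub>2 G A) \<subseteq> S"
  using assms
proof (induction A arbitrary: xs)
  case (Gen3 k)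
  then obtain l r where lr: "(l, r) \<in> Rs" "src3 G k = strand (src2 G (hd l)) l"
    "tgt3 G k = strand (src2 G (hd l)) r"
    using cells[of k] by auto
  note rule = rules[OF lr(1)]
  have wf: "wf2 G (strand (src2 G (hd l)) l)" "wf2 G (strand (src2 G (hd l)) r)"
    "t\<^sub>1 G (strand (src2 G (hd l)) l) = t\<^sub>1 G (strand (src2 G (hd l)) r)"
    using polygraph Gen3.prems(1) lr(2,3) by (auto simp: polygraph3_def)
  have "length (t\<^sub>1 G (strand (src2 G (hd l)) l)) = 1"
    using t1_strand_linear[OF wf(1)] rule by simp
  then have "flow G (src3 G k) xs = [concat xs @ l]" "flow G (tgt3 G k) xs = [concat xs @ r]"
    using wf rule linear Gen3.prems(4) lr
    by (auto intro!: flow_strand)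
  moreover have "srewrite Rs (concat xs @ l) (concat xs @ r)"
    using srewrite.intros[OF lr(1), of "concat xs" "[]"] by simp
  ultimately show ?case
    using rule lr(3) step_at.intros[of "srewrite Rs" _ _ "[]" "[]"] by simp
next
  case (Comp3_0 A B)
  then have wf: "wf3 G A" "wf3 G B" and S: "gens (s\<^sub>2 G A) \<subseteq> S" "gens (s\<^sub>2 G B) \<subseteq> S"
    by auto
  note bd = wf3_boundary[OF polygraph wf(1)]
  let ?n = "length (s\<^sub>1 G (s\<^sub>2 G A))"
  have len: "length (take ?n xs) = ?n" "length (drop ?n xs) = length (s\<^sub>1 G (s\<^sub>2 G B))"
    using Comp3_0.prems by auto
  consider "count3 A = 1" "count3 B = 0" | "count3 A = 0" "count3 B = 1"
    using Comp3_0.prems(2) by fastforce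
  then show ?case
  proof cases
    case 1
    have eq: "eq2 G (s\<^sub>2 G B) (t\<^sub>2 G B)"
      using wf3_identity[OF polygraph wf(2) 1(2)] .
    show ?thesis
      using Comp3_0.IH(1)[OF wf(1) 1(1) S(1) len(1)] eq2_flow[OF polygraph eq len(2)]
        eq2_gens[OF eq] S(2) bd by (auto intro: step_at_append1)
  next
    case 2
    have eq: "eq2 G (s\<^sub>2 G A) (t\<^sub>2 G A)"
      using wf3_identity[OF polygraph wf(1) 2(1)] .
    show ?thesis
      using Comp3_0.IH(2)[OF wf(2) 2(2) S(2) len(2)] eq2_flow[OF polygraph eq len(1)]
        eq2_gens[OF eq] S(1) bd by (auto intro: step_at_append2)
  qed
next
  case (Comp3_1 A B)
  then have wf: "wf3 G A" "wf3 G B" and S: "gens (s\<^sub>2 G A) \<subseteq> S" "gens (s\<^sub>2 G B) \<subseteq> S"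
    and len: "length xs = length (s\<^sub>1 G (s\<^sub>2 G A))" and comp: "t\<^sub>1 G (s\<^sub>2 G A) = s\<^sub>1 G (s\<^sub>2 G B)"
    by auto
  note bdA = wf3_boundary[OF polygraph wf(1)] and bdB = wf3_boundary[OF polygraph wf(2)]
  have lenA: "length (flow G (s\<^sub>2 G A) xs) = length (s\<^sub>1 G (s\<^sub>2 G B))"
    "length (flow G (t\<^sub>2 G A) xs) = length (s\<^sub>1 G (s\<^sub>2 G B))"
    using bdA len comp by (simp_all add: length_flow)
  consider "count3 A = 1" "count3 B = 0" | "count3 A = 0" "count3 B = 1"
    using Comp3_1.prems(2) by fastforce
  then show ?case
  proof cases
    case 1
    have eq: "eq2 G (s\<^sub>2 G B) (t\<^sub>2 G B)"
      using wf3_identity[OF polygraph wf(2) 1(2)] .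
    \<comment> \<open>The string changed by \<open>A\<close> still has to pass through
      \<open>B\<close>, which is where linearity of the 2-cells enters.\<close>
    have "step_at (srewrite Rs) (flow G (s\<^sub>2 G B) (flow G (s\<^sub>2 G A) xs))
        (flow G (s\<^sub>2 G B) (flow G (t\<^sub>2 G A) xs))"
      using Comp3_1.IH(1)[OF wf(1) 1(1) S(1) len] bdB lenA S(2) linear
      by (intro flow_step_at) auto
    then show ?thesis
      using Comp3_1.IH(1)[OF wf(1) 1(1) S(1) len] eq2_flow[OF polygraph eq lenA(2)]
        eq2_gens[OF eq] S(2) by simp
  next
    case 2
    have eq: "eq2 G (s\<^sub>2 G A) (t\<^sub>2 G A)"
      using wf3_identity[OF polygraph wf(1) 2(1)] .
    show ?thesis
      using Comp3_1.IH(2)[OF wf(2) 2(2) S(2) lenA(1)] eq2_flow[OF polygraph eq len]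
        eq2_gens[OF eq] S(1) by simp
  qed
next
  case (Comp3_2 A B)
  then have wf: "wf3 G A" "wf3 G B" and S: "gens (s\<^sub>2 G A) \<subseteq> S"
    and len: "length xs = length (s\<^sub>1 G (s\<^sub>2 G A))" and eq: "eq2 G (t\<^sub>2 G A) (s\<^sub>2 G B)"
    by auto
  note bdA = wf3_boundary[OF polygraph wf(1)] and bd = eq2_wf_boundary[OF polygraph eq]
  have len': "length xs = length (s\<^sub>1 G (t\<^sub>2 G A))" "length xs = length (s\<^sub>1 G (s\<^sub>2 G B))"
    using len bdA bd by auto
  note flow_eq = eq2_flow[OF polygraph eq len'(1)]
  consider "count3 A = 1" "count3 B = 0" | "count3 A = 0" "count3 B = 1"
    using Comp3_2.prems(2) by fastforce
  then show ?case
  proof cases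
    case 1
    have eqB: "eq2 G (s\<^sub>2 G B) (t\<^sub>2 G B)"
      using wf3_identity[OF polygraph wf(2) 1(2)] .
    show ?thesis
      using Comp3_2.IH(1)[OF wf(1) 1(1) S len] flow_eq eq2_flow[OF polygraph eqB len'(2)]
        eq2_gens[OF eq] eq2_gens[OF eqB] by simp
  next
    case 2
    have eqA: "eq2 G (s\<^sub>2 G A) (t\<^sub>2 G A)"
      using wf3_identity[OF polygraph wf(1) 2(1)] .
    have "gens (s\<^sub>2 G B) \<subseteq> S"
      using S eq2_gens[OF eqA] eq2_gens[OF eq] by simp
    then show ?thesis
      using Comp3_2.IH(2)[OF wf(2) 2(2) _ len'(2)] flow_eq eq2_flow[OF polygraph eqA len] by simp
  qed
qed simp

section \<open>Correspondence between string rewriting and rewriting of 2-paths\<close>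

definition closed_string :: "'c list \<Rightarrow> bool" where
  "closed_string s \<longleftrightarrow> wf2 G (strand [] s) \<and> set s \<subseteq> S \<and> s \<noteq> []"

lemma flow_closed_string:
  assumes "closed_string s"
  shows "flow G (strand [] s) [] = [s]"
  using assms linear t1_strand_linear by (subst flow_strand) (auto simp: closed_string_def)

text \<open>Evaluating any representative on the empty tuple recovers the string.\<close>

lemma path2_strand_inject:
  assumes "closed_string s" "closed_string s'" "path2 G (strand [] s) = path2 G (strand [] s')"
  shows "s = s'"
proof -
  have "eq2 G (strand [] s) (strand [] s')"
    using assms by (simp add: path2_eq_iff closed_string_def)
  then show ?thesis
    using eq2_flow[OF polygraph, of "strand [] s" "strand [] s'" "[]"] assms
    by (simp add: flow_closed_string)
qed

lemma closed_term_strand: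
  assumes "wf2 G t" "gens t \<subseteq> S" "s\<^sub>1 G t = []" "length (t\<^sub>1 G t) = 1"
  obtains s where "flow G t [] = [s]" "closed_string s" "eq2 G t (strand [] s)"
proof -
  obtain s where s: "flow G t [] = [s]" "eq2 G t (strand [] s)"
    using closed_linear_term[OF polygraph assms(1,3,4)] assms(2) linear by blast
  have "s \<noteq> []"
    using eq2_wf_boundary[OF polygraph s(2)] assms(4) by auto
  then have "closed_string s"
    using eq2_wf_boundary[OF polygraph s(2)] eq2_gens[OF s(2)] assms(2)
    by (auto simp: closed_string_def)
  then show ?thesis
    using that s by blast
qed

text \<open>The witness \<open>A\<close> has an unknown shape, but the flow of its source is the
  single string \<open>s\<close>, so the flow of its target is one rewriting of \<open>s\<close>;
  completeness of the flow then turns the target back into a strand.\<close>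

lemma rewrite_step_strand:
  assumes "closed_string s" "rewrite_step G (path2 G (strand [] s)) Y"
  obtains s' where "closed_string s'" "Y = path2 G (strand [] s')" "srewrite Rs s s'"
proof -
  obtain A where A: "wf3 G A" "count3 A = 1" "path2 G (strand [] s) = path2 G (s\<^sub>2 G A)"
    "Y = path2 G (t\<^sub>2 G A)"
    using assms(2) by (auto simp: rewrite_step_def)
  have wf: "wf2 G (strand [] s)" and S: "set s \<subseteq> S" and ne: "s \<noteq> []"
    using assms(1) by (auto simp: closed_string_def)
  have eq: "eq2 G (strand [] s) (s\<^sub>2 G A)"
    using A(3) path2_eq_iff[OF wf] by blast
  note bd = eq2_wf_boundary[OF polygraph eq] and bdA = wf3_boundary[OF polygraph A(1)]
  have flow_s: "flow G (s\<^sub>2 G A) [] = [s]"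
    using eq2_flow[OF polygraph eq, of "[]"] flow_closed_string[OF assms(1)] by simp
  have step: "step_at (srewrite Rs) [s] (flow G (t\<^sub>2 G A) [])" "gens (t\<^sub>2 G A) \<subseteq> S"
    using step_flow[OF A(1,2), of "[]"] eq2_gens[OF eq] S bd flow_s by auto
  have "length (t\<^sub>1 G (t\<^sub>2 G A)) = 1"
    using bd bdA t1_strand_linear[OF wf S ne] by simp
  then obtain s' where s': "flow G (t\<^sub>2 G A) [] = [s']" "closed_string s'"
    "eq2 G (t\<^sub>2 G A) (strand [] s')"
    using closed_term_strand[of "t\<^sub>2 G A"] step(2) bd bdA by auto
  have "Y = path2 G (strand [] s')"
    using A(4) s'(3) bdA path2_eq_iff by blast
  then show ?thesis
    using that s' step(1) step_at_singleton by fastforce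
qed

text \<open>A redex inside a string is a 3-cell composed with identities on both sides; typing of
  the whole string makes the three pieces composable.\<close>

lemma strand_rewrite_step:
  assumes "closed_string s" "srewrite Rs s s'"
  shows "rewrite_step G (path2 G (strand [] s)) (path2 G (strand [] s'))" "closed_string s'"
proof -
  obtain l r p q where lr: "(l, r) \<in> Rs" and s: "s = p @ l @ q" and s': "s' = p @ r @ q"
    using assms(2) by (auto elim: srewrite.cases)
  define u where "u = src2 G (hd l)"
  obtain k where k: "k \<in> cells3 G" "src3 G k = strand u l" "tgt3 G k = strand u r"
    and l: "l \<noteq> []" "set l \<subseteq> S" "set r \<subseteq> S"
    using rules[OF lr] by (auto simp: u_def)
  define v where "v = t\<^sub>1 G (strand u l)"
  have bd: "wf2 G (strand u l)" "wf2 G (strand u r)" "t\<^sub>1 G (strand u r) = v"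
    using polygraph k by (auto simp: polygraph3_def v_def)
  obtain z where z: "chain (src2 G) (tgt2 G) [] s z" and sc: "set s \<subseteq> cells2 G"
    using assms(1) wf2_strand[of G "[]" s "t\<^sub>1 G (strand [] s)"] that
    by (auto simp: closed_string_def)
  then obtain m n where ch: "chain (src2 G) (tgt2 G) [] p m" "chain (src2 G) (tgt2 G) m l n"
    "chain (src2 G) (tgt2 G) n q z"
    by (auto simp: s chain_append)
  have m: "m = u"
    using ch(2) l(1) by (cases l) (auto simp: u_def)
  have n: "n = v"
    using ch(2) m sc s bd(1) wf2_strand[of G u l n] wf2_strand[of G u l v] by (auto simp: v_def)
  have wfp: "wf2 G (strand [] p)" "t\<^sub>1 G (strand [] p) = u"
    using ch(1) m sc s wf2_strand[of G "[]" p u] by auto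
  have "v \<in> lists (cells1 G)"
    using wf2_boundary(2)[OF polygraph bd(1)] by (simp add: v_def)
  then have wfq: "wf2 G (strand v q)" "t\<^sub>1 G (strand v q) = z"
    using ch(3) n sc s wf2_strand[of G v q z] by auto
  \<comment> \<open>Stated for every \<open>x\<close> parallel to the left-hand side, so that one
    argument serves both sides of the rule.\<close>
  have dec: "eq2 G (strand [] (p @ x @ q)) (strand [] p \<star>\<^sub>1 strand u x \<star>\<^sub>1 strand v q)"
    and wfx: "wf2 G (strand [] (p @ x @ q))"
    if x: "wf2 G (strand u x)" "t\<^sub>1 G (strand u x) = v" for x
  proof -
    have "chain (src2 G) (tgt2 G) u x v" "set x \<subseteq> cells2 G"
      using x wf2_strand[of G u x v] by auto
    then have "wf2 G (strand [] (p @ x @ q)) \<and> t\<^sub>1 G (strand [] (p @ x @ q)) = z"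
      using ch(1,3) m n sc s by (subst wf2_strand) (auto simp: chain_append)
    then show wf: "wf2 G (strand [] (p @ x @ q))" ..
    have 1: "eq2 G (strand [] (p @ x @ q)) (strand [] p \<star>\<^sub>1 strand u (x @ q))"
      using strand_append[OF polygraph wf] wfp(2) by simp
    then have "wf2 G (strand u (x @ q))"
      using eq2_wf_boundary[OF polygraph 1] by simp
    then have 2: "eq2 G (strand u (x @ q)) (strand u x \<star>\<^sub>1 strand v q)"
      using strand_append[OF polygraph, of u x q] x by simp
    show "eq2 G (strand [] (p @ x @ q)) (strand [] p \<star>\<^sub>1 strand u x \<star>\<^sub>1 strand v q)"
      by (rule eq2_trans[OF 1]) (use wfp 2 in \<open>auto intro!: eq2_cong1 eq2_refl\<close>)
  qed
  define A where "A = Comp3_1 (Ident3 (strand [] p)) (Comp3_1 (Gen3 k) (Ident3 (strand v q)))"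
  have "wf3 G A" "count3 A = 1"
    using wfp wfq k by (auto simp: A_def v_def)
  moreover have "path2 G (strand [] s) = path2 G (s\<^sub>2 G A)"
    using dec[of l] wfx[of l] bd k by (simp add: path2_eq_iff s A_def v_def)
  moreover have "path2 G (strand [] s') = path2 G (t\<^sub>2 G A)"
    using dec[of r] wfx[of r] bd k by (simp add: path2_eq_iff s' A_def)
  ultimately show "rewrite_step G (path2 G (strand [] s)) (path2 G (strand [] s'))"
    unfolding rewrite_step_def by blast
  \<comment> \<open>Right-hand sides may be empty. If nothing at all remained, the left-hand side
    would have the empty word as target, against coarity 1.\<close>
  have "s' \<noteq> []"
  proof
    assume "s' = []"
    then have "p = []" "r = []"
      by (simp_all add: s')
    then have "u = []" "v = []"
      using wfp bd(3) by simp_all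
    then show False
      using t1_strand_linear[OF bd(1) l(2,1)] by (simp add: v_def)
  qed
  then show "closed_string s'"
    using wfx[of r] bd l(3) assms(1) by (auto simp: closed_string_def s s')
qed

lemma srewrite_rtranclp:
  assumes "(srewrite Rs)\<^sup>*\<^sup>* s s'" "closed_string s"
  shows "(rewrite_step G)\<^sup>*\<^sup>* (path2 G (strand [] s)) (path2 G (strand [] s')) \<and> closed_string s'"
  using assms by induction (auto intro: strand_rewrite_step rtranclp.rtrancl_into_rtrancl)

lemma rewrite_rtranclp:
  assumes "(rewrite_step G)\<^sup>*\<^sup>* (path2 G (strand [] s)) Y" "closed_string s"
  shows "\<exists>s'. closed_string s' \<and> Y = path2 G (strand [] s') \<and> (srewrite Rs)\<^sup>*\<^sup>* s s'"
  using assms by induction (blast elim: rewrite_step_strand intro: rtranclp.rtrancl_into_rtrancl)+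

text \<open>By determinism every string reached from \<open>s\<close> lies on the path to
  \<open>n\<close> and still leads there. Determinism is asked only at reachable strings, because
  only these will be known to encode stacks.\<close>

lemma unique_normal_form_strand:
  assumes "closed_string s" "(srewrite Rs)\<^sup>*\<^sup>* s n" "\<And>t. \<not> srewrite Rs n t"
    and det: "\<And>x y z. (srewrite Rs)\<^sup>*\<^sup>* s x \<Longrightarrow> srewrite Rs x y \<Longrightarrow> srewrite Rs x z \<Longrightarrow> y = z"
  shows "unique_normal_form G (path2 G (strand [] s)) (path2 G (strand [] n))"
proof -
  have reach: "(srewrite Rs)\<^sup>*\<^sup>* x n" if "(srewrite Rs)\<^sup>*\<^sup>* s x" for x
    using that
  proof induction
    case base
    show ?case
      by (rule assms(2))
  next
    case (step x y)
    from step.IH show ?case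
    proof (cases rule: converse_rtranclpE)
      case base
      then show ?thesis
        using step.hyps(2) assms(3) by blast
    next
      case (step z)
      then show ?thesis
        using det \<open>(srewrite Rs)\<^sup>*\<^sup>* s x\<close> \<open>srewrite Rs x y\<close> by blast
    qed
  qed
  have n: "closed_string n" "(rewrite_step G)\<^sup>*\<^sup>* (path2 G (strand [] s)) (path2 G (strand [] n))"
    using srewrite_rtranclp[OF assms(2,1)] by blast+
  have "normal_form G (path2 G (strand [] n))"
    unfolding normal_form_def
  proof
    show "path2 G (strand [] n) \<in> paths2 G"
      using n(1) by (simp add: paths2_def closed_string_def)
    show "\<nexists>Y. rewrite_step G (path2 G (strand [] n)) Y"
    proof
      assume "\<exists>Y. rewrite_step G (path2 G (strand [] n)) Y"
      then obtain Y where "rewrite_step G (path2 G (strand [] n)) Y" ..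
      from rewrite_step_strand[OF n(1) this] show False
        using assms(3) by blast
    qed
  qed
  moreover have "Y = path2 G (strand [] n)"
    if Y: "(rewrite_step G)\<^sup>*\<^sup>* (path2 G (strand [] s)) Y" "normal_form G Y" for Y
  proof -
    obtain x where x: "closed_string x" "Y = path2 G (strand [] x)" "(srewrite Rs)\<^sup>*\<^sup>* s x"
      using rewrite_rtranclp[OF Y(1) assms(1)] by blast
    have "\<not> srewrite Rs x y" for y
      using Y(2) strand_rewrite_step(1)[OF x(1)] x(2) unfolding normal_form_def by blast
    with reach[OF x(3)] have "x = n"
      by (cases rule: converse_rtranclpE) blast+
    then show ?thesis
      using x(2) by simp
  qed
  ultimately show ?thesis
    using n(2) unfolding unique_normal_form_def by blast
qed

end


section \<open>Turing machines as deterministic stack machines\<close>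

text \<open>
  A configuration is split into a stack of constructors, holding the right part of the tape, and a
  stack of function 2-cells, holding the left part. The right part consists of arbitrary symbols
  \<open>Sym\<close> on top of the not yet visited suffix of the input, which is still made of the constructors
  \<open>Letter\<close>; \<open>Lift\<close> separates the two. A rule sees only one function 2-cell, so a move to the left
  parks the state in the constructor \<open>State\<close> before it inspects the left part.
\<close>

datatype ('a, 'q) tm_con = Empty | Letter 'a | Lift | Sym "'a option" | State 'q | Erase

text \<open>\<open>End\<close> marks the bottom of the left part, so that a rule can detect it.
  After halting, \<open>Conv\<close> takes the symbols of the result off the tape and leaves them as
  \<open>Push\<close> cells, which put them back as letters.\<close>

datatype ('a, 'q) tm_fun = Start | Head 'q "'a option" | Left "'a option" | End | Conv | Push 'a

definition tm_cons :: "('a, 'q) turing_machine \<Rightarrow> ('a, 'q) tm_con set" where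
  "tm_cons M = {Empty, Lift, Erase} \<union> Letter ` alphabet M \<union> Sym ` ext_alphabet M \<union> State ` states M"

definition tm_funs :: "('a, 'q) turing_machine \<Rightarrow> ('a, 'q) tm_fun set" where
  "tm_funs M = {Start, End, Conv} \<union> case_prod Head ` (states M \<times> ext_alphabet M)
     \<union> Left ` ext_alphabet M \<union> Push ` alphabet M"

type_synonym ('a, 'q) stack = "('a, 'q) tm_con list \<times> ('a, 'q) tm_fun list"
type_synonym ('a, 'q) rule =
  "('a, 'q) tm_con list \<times> ('a, 'q) tm_fun \<times> ('a, 'q) tm_con list \<times> ('a, 'q) tm_fun list"

text \<open>Lists are given top first. Some rules read a constructor \<open>x\<close> only to put it
  back: without it their left-hand side would be a lone function 2-cell, which could fire anywhere.
  The rule \<open>conv_sym\<close> covers letters only, since the right part of a final tape is free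
  of blanks.\<close>

inductive_set tm_rules :: "('a, 'q) turing_machine \<Rightarrow> ('a, 'q) rule set" for M where
  start: "x \<in> insert Empty (Letter ` alphabet M) \<Longrightarrow>
    ([x], Start, [Lift, x], [Head (init M) None, End]) \<in> tm_rules M"
| right_sym: "q \<in> states M \<Longrightarrow> q \<noteq> final M \<Longrightarrow> a \<in> ext_alphabet M \<Longrightarrow> trans M q a = (q', c, R) \<Longrightarrow>
    b \<in> ext_alphabet M \<Longrightarrow> ([Sym b], Head q a, [], [Head q' b, Left c]) \<in> tm_rules M"
| right_letter: "q \<in> states M \<Longrightarrow> q \<noteq> final M \<Longrightarrow> a \<in> ext_alphabet M \<Longrightarrow> trans M q a = (q', c, R) \<Longrightarrow>
    b \<in> alphabet M \<Longrightarrow> ([Lift, Letter b], Head q a, [Lift], [Head q' (Some b), Left c]) \<in> tm_rules M"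
| right_empty: "q \<in> states M \<Longrightarrow> q \<noteq> final M \<Longrightarrow> a \<in> ext_alphabet M \<Longrightarrow> trans M q a = (q', c, R) \<Longrightarrow>
    ([Lift, Empty], Head q a, [Lift, Empty], [Head q' None, Left c]) \<in> tm_rules M"
| left: "q \<in> states M \<Longrightarrow> q \<noteq> final M \<Longrightarrow> a \<in> ext_alphabet M \<Longrightarrow> trans M q a = (q', c, L) \<Longrightarrow>
    x \<in> insert Lift (Sym ` ext_alphabet M) \<Longrightarrow> ([x], Head q a, [State q', Sym c, x], []) \<in> tm_rules M"
| left_sym: "q \<in> states M \<Longrightarrow> b \<in> ext_alphabet M \<Longrightarrow>
    ([State q], Left b, [], [Head q b]) \<in> tm_rules M"
| left_end: "q \<in> states M \<Longrightarrow> ([State q], End, [], [Head q None, End]) \<in> tm_rules M"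
| halt: "a \<in> ext_alphabet M \<Longrightarrow> x \<in> insert Lift (Sym ` ext_alphabet M) \<Longrightarrow>
    ([x], Head (final M) a, [Erase, x], []) \<in> tm_rules M"
| erase_sym: "b \<in> ext_alphabet M \<Longrightarrow> ([Erase], Left b, [Erase], []) \<in> tm_rules M"
| erase_end: "([Erase], End, [], [Conv]) \<in> tm_rules M"
| conv_sym: "a \<in> alphabet M \<Longrightarrow> ([Sym (Some a)], Conv, [], [Conv, Push a]) \<in> tm_rules M"
| conv_lift: "([Lift], Conv, [], []) \<in> tm_rules M"
| push: "x \<in> insert Empty (Letter ` alphabet M) \<Longrightarrow> a \<in> alphabet M \<Longrightarrow>
    ([x], Push a, [Letter a, x], []) \<in> tm_rules M"

inductive stack_step :: "('a, 'q) turing_machine \<Rightarrow> ('a, 'q) stack \<Rightarrow> ('a, 'q) stack \<Rightarrow> bool" for M where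
  "(l, f, r, g) \<in> tm_rules M \<Longrightarrow> stack_step M (l @ p, f # q) (r @ p, g @ q)"

text \<open>For \<open>Head q a\<close>, the tests on the final state and on the direction of the
  transition separate halting, left and right moves; within each kind, and for all other functions,
  the top constructors decide.\<close>

lemma tm_rules_deterministic:
  assumes "(l, f, r, g) \<in> tm_rules M" "(l', f, r', g') \<in> tm_rules M" "l @ p = l' @ p'"
  shows "l = l' \<and> r = r' \<and> g = g' \<and> p = p'"
  using assms(1)
  by cases (use assms(2,3) in \<open>cases; auto\<close>)+

lemma stack_step_deterministic: "stack_step M s t \<Longrightarrow> stack_step M s t' \<Longrightarrow> t = t'"
  by (auto elim!: stack_step.cases dest: tm_rules_deterministic)

lemma trans_closed:
  assumes "turing_machine M" "q \<in> states M" "q \<noteq> final M" "a \<in> ext_alphabet M"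
    "trans M q a = (q', c, d)"
  shows "q' \<in> states M" "c \<in> ext_alphabet M"
proof -
  have "trans M q a \<in> states M \<times> ext_alphabet M \<times> UNIV"
    using assms(1-4) unfolding turing_machine_def by blast
  then show "q' \<in> states M" "c \<in> ext_alphabet M"
    using assms(5) by auto
qed

lemma tm_rules_cells:
  assumes "turing_machine M" "(l, f, r, g) \<in> tm_rules M"
  shows "l \<noteq> [] \<and> set l \<subseteq> tm_cons M \<and> f \<in> tm_funs M \<and> set r \<subseteq> tm_cons M \<and> set g \<subseteq> tm_funs M"
proof -
  have "init M \<in> states M" "final M \<in> states M" "None \<in> ext_alphabet M"
    "\<And>b. b \<in> alphabet M \<Longrightarrow> Some b \<in> ext_alphabet M"
    using assms(1) by (auto simp: turing_machine_def ext_alphabet_def)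
  note cells = this
  from assms(2) show ?thesis
    by cases (use cells in \<open>auto simp: tm_cons_def tm_funs_def image_iff dest: trans_closed[OF assms(1)]\<close>)
qed

lemma finite_tm_cells:
  assumes "turing_machine M"
  shows "finite (tm_cons M)" "finite (tm_funs M)"
  using assms by (auto simp: tm_cons_def tm_funs_def turing_machine_def ext_alphabet_def)

lemma finite_tm_rules:
  assumes "turing_machine M"
  shows "finite (tm_rules M)"
proof -
  \<comment> \<open>The bound 3 is reached by the rule \<open>left\<close>, which writes a state, a
    symbol and the restored top.\<close>
  have "tm_rules M \<subseteq> {l. set l \<subseteq> tm_cons M \<and> length l \<le> 3} \<times> tm_funs M \<times>
      {r. set r \<subseteq> tm_cons M \<and> length r \<le> 3} \<times> {g. set g \<subseteq> tm_funs M \<and> length g \<le> 3}"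
  proof
    fix z
    assume "z \<in> tm_rules M"
    then obtain l f r g where z: "z = (l, f, r, g)" and rule: "(l, f, r, g) \<in> tm_rules M"
      by (cases z) auto
    from rule have "length l \<le> 3 \<and> length r \<le> 3 \<and> length g \<le> 3"
      by cases auto
    then show "z \<in> {l. set l \<subseteq> tm_cons M \<and> length l \<le> 3} \<times> tm_funs M \<times>
      {r. set r \<subseteq> tm_cons M \<and> length r \<le> 3} \<times> {g. set g \<subseteq> tm_funs M \<and> length g \<le> 3}"
      using tm_rules_cells[OF assms rule] z by simp
  qed
  then show ?thesis
    by (rule finite_subset) (simp add: finite_tm_cells[OF assms] finite_lists_length_le)
qed

section \<open>Simulation of machine moves by stack steps\<close>

inductive represents :: "('a, 'q) turing_machine \<Rightarrow> ('a, 'q) config \<Rightarrow> ('a, 'q) stack \<Rightarrow> bool" for M where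
  "q \<in> states M \<Longrightarrow> a \<in> ext_alphabet M \<Longrightarrow> set l \<subseteq> ext_alphabet M \<Longrightarrow> set y \<subseteq> ext_alphabet M \<Longrightarrow>
   set x \<subseteq> alphabet M \<Longrightarrow>
   represents M (q, a, l, y @ map Some x)
     (map Sym y @ Lift # map Letter x @ [Empty], Head q a # map Left l @ [End])"

text \<open>The right part always shows \<open>Lift\<close> or a symbol on top, just what the rules
  \<open>left\<close> and \<open>halt\<close> read and restore.\<close>

lemma Cons_map_Lift:
  fixes M :: "('a, 'q) turing_machine"
  assumes "set y \<subseteq> ext_alphabet M"
  obtains c :: "('a, 'q) tm_con" and cs where "map Sym y @ Lift # z = c # cs" "c \<in> insert Lift (Sym ` ext_alphabet M)"
  using assms by (cases y) auto

lemma stack_step_move_left: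
  fixes M :: "('a, 'q) turing_machine"
  assumes "q \<in> states M" "q \<noteq> final M" "a \<in> ext_alphabet M" "trans M q a = (q', c, L)"
    and "set y \<subseteq> ext_alphabet M"
  shows "stack_step M (map Sym y @ Lift # z, Head q a # k)
    (State q' # map Sym (c # y) @ Lift # z, k)"
proof -
  obtain d :: "('a, 'q) tm_con" and ds where d: "map Sym y @ Lift # z = d # ds" "d \<in> insert Lift (Sym ` ext_alphabet M)"
    using Cons_map_Lift[OF assms(5)] .
  show ?thesis
    using stack_step.intros[OF tm_rules.left[OF assms(1-4) d(2)], of ds k] d(1) by simp
qed

text \<open>A move to the right takes one stack step, a move to the left two, through
  \<open>State\<close>. A configuration can have several stacks, as the tape does not tell where the
  visited symbols \<open>y\<close> end and the untouched input \<open>x\<close> begins; hence the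
  simulation is a relation.\<close>

lemma stack_step_tm_step:
  fixes M :: "('a, 'q) turing_machine"
  assumes "turing_machine M" "tm_step M C C'" "represents M C s"
  shows "\<exists>s'. represents M C' s' \<and> (stack_step M)\<^sup>*\<^sup>* s s'"
  using assms(3)
proof cases
  case (1 q a l y x)
  note C = 1(1) and s = 1(2) and valid = 1(3-)
  have none: "None \<in> ext_alphabet M"
    by (simp add: ext_alphabet_def)
  let ?z = "map Letter x @ [Empty] :: ('a, 'q) tm_con list"
  obtain q' c d where tr: "trans M q a = (q', c, d)" and q: "q \<noteq> final M"
    using assms(2) by (auto simp: C elim: tm_step.cases)
  have valid': "q' \<in> states M" "c \<in> ext_alphabet M"
    using trans_closed[OF assms(1) valid(1) q valid(2) tr] .
  show ?thesis
  proof (cases d)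
    case L
    define s' where "s' b l' =
      (map Sym (c # y) @ Lift # ?z, Head q' b # map Left l' @ [End] :: ('a, 'q) tm_fun list)" for b l'
    have step: "stack_step M s (State q' # map Sym (c # y) @ Lift # ?z, map Left l @ [End])"
      unfolding s using stack_step_move_left[OF valid(1) q valid(2) tr[unfolded L] valid(4)] .
    have rep: "represents M (q', b, l', (c # y) @ map Some x) (s' b l')"
      if "b \<in> ext_alphabet M" "set l' \<subseteq> ext_alphabet M" for b l'
      unfolding s'_def using valid valid' that by (intro represents.intros) auto
    show ?thesis
    proof (cases l)
      case Nil
      have "C' = (q', None, [], (c # y) @ map Some x)"
        using assms(2) tr L Nil by (auto simp: C elim: tm_step.cases)
      moreover have "stack_step M (State q' # map Sym (c # y) @ Lift # ?z, map Left l @ [End]) (s' None [])"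
        using stack_step.intros[OF tm_rules.left_end[OF valid'(1)], of "map Sym (c # y) @ Lift # ?z" "[]"]
        by (simp add: s'_def Nil)
      ultimately show ?thesis
        using step rep[OF none, of "[]"]
        by (auto simp del: split_paired_Ex intro!: exI[of _ "s' None []"] intro: rtranclp.rtrancl_into_rtrancl)
    next
      case (Cons b l')
      have "C' = (q', b, l', (c # y) @ map Some x)"
        using assms(2) tr L Cons by (auto simp: C elim: tm_step.cases)
      moreover have b: "b \<in> ext_alphabet M" "set l' \<subseteq> ext_alphabet M"
        using valid(3) Cons by auto
      moreover have "stack_step M (State q' # map Sym (c # y) @ Lift # ?z, map Left l @ [End]) (s' b l')"
        using stack_step.intros[OF tm_rules.left_sym[OF valid'(1) b(1)],
            of "map Sym (c # y) @ Lift # ?z" "map Left l' @ [End]"]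
        by (simp add: s'_def Cons)
      ultimately show ?thesis
        using step rep[OF b]
        by (auto simp del: split_paired_Ex intro!: exI[of _ "s' b l'"] intro: rtranclp.rtrancl_into_rtrancl)
    qed
  next
    case R
    define s' where "s' b y' x' = (map Sym y' @ Lift # map Letter x' @ [Empty] :: ('a, 'q) tm_con list,
      Head q' b # map Left (c # l) @ [End] :: ('a, 'q) tm_fun list)" for b y' x'
    have rep: "represents M (q', b, c # l, y' @ map Some x') (s' b y' x')"
      if "b \<in> ext_alphabet M" "set y' \<subseteq> ext_alphabet M" "set x' \<subseteq> alphabet M" for b y' x'
      unfolding s'_def using valid valid' that by (intro represents.intros) auto
    note rule = valid(1) q valid(2) tr[unfolded R]
    consider (sym) b y' where "y = b # y'" | (letter) b x' where "y = []" "x = b # x'"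
      | (empty) "y = []" "x = []"
      by (meson list.exhaust)
    then show ?thesis
    proof cases
      case sym
      have "C' = (q', b, c # l, y' @ map Some x)"
        using assms(2) tr R sym by (auto simp: C elim: tm_step.cases)
      moreover have b: "b \<in> ext_alphabet M" "set y' \<subseteq> ext_alphabet M"
        using valid(4) sym by auto
      moreover have "stack_step M s (s' b y' x)"
        using stack_step.intros[OF tm_rules.right_sym[OF rule b(1)],
            of "map Sym y' @ Lift # ?z" "map Left l @ [End]"]
        by (simp add: s'_def s sym)
      ultimately show ?thesis
        using rep[OF b valid(5)] by blast
    next
      case letter
      have "C' = (q', Some b, c # l, [] @ map Some x')"
        using assms(2) tr R letter by (auto simp: C elim: tm_step.cases)
      moreover have b: "b \<in> alphabet M" "Some b \<in> ext_alphabet M" "set x' \<subseteq> alphabet M"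
        using valid(5) letter by (auto simp: ext_alphabet_def)
      moreover have "stack_step M s (s' (Some b) [] x')"
        using stack_step.intros[OF tm_rules.right_letter[OF rule b(1)],
            of "map Letter x' @ [Empty]" "map Left l @ [End]"]
        by (simp add: s'_def s letter)
      ultimately show ?thesis
        using rep[OF b(2) _ b(3), of "[]"]
        by (auto simp del: split_paired_Ex intro!: exI[of _ "s' (Some b) [] x'"])
    next
      case empty
      have "C' = (q', None, c # l, [] @ map Some [])"
        using assms(2) tr R empty by (auto simp: C elim: tm_step.cases)
      moreover have "stack_step M s (s' None [] [])"
        using stack_step.intros[OF tm_rules.right_empty[OF rule], of "[]" "map Left l @ [End]"]
        by (simp add: s'_def s empty)
      ultimately show ?thesis
        using rep[OF none, of "[]" "[]"]
        by (auto simp del: split_paired_Ex intro!: exI[of _ "s' None [] []"])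
    qed
  qed
qed

lemma stack_step_tm_steps:
  assumes "(tm_step M)\<^sup>*\<^sup>* C C'" "turing_machine M" "represents M C s"
  shows "\<exists>s'. represents M C' s' \<and> (stack_step M)\<^sup>*\<^sup>* s s'"
  using assms(1)
proof induction
  case base
  then show ?case
    using assms(3) by blast
next
  case (step C' C'')
  then show ?case
    using stack_step_tm_step[OF assms(2)] by (meson rtranclp_trans)
qed

section \<open>Extraction of the result after halting\<close>

lemma stack_step_erase:
  assumes "set l \<subseteq> ext_alphabet M"
  shows "(stack_step M)\<^sup>*\<^sup>* (Erase # p, map Left l @ [End]) (p, [Conv])"
  using assms
proof (induction l)
  case Nil
  show ?case
    using stack_step.intros[OF tm_rules.erase_end, of M p "[]"] by auto
next
  case (Cons b l)
  then have "stack_step M (Erase # p, map Left (b # l) @ [End]) (Erase # p, map Left l @ [End])"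
    using stack_step.intros[OF tm_rules.erase_sym, of b M p "map Left l @ [End]"] by simp
  then show ?case
    using Cons by (auto intro: converse_rtranclp_into_rtranclp)
qed

text \<open>Moving the symbols under \<open>Conv\<close> reverses them; pushing them back reverses
  them again.\<close>

lemma stack_step_conv:
  assumes "set y \<subseteq> alphabet M"
  shows "(stack_step M)\<^sup>*\<^sup>* (map Sym (map Some y) @ Lift # p, Conv # g) (p, map Push (rev y) @ g)"
  using assms
proof (induction y arbitrary: g)
  case Nil
  show ?case
    using stack_step.intros[OF tm_rules.conv_lift, of M p g] by auto
next
  case (Cons a y)
  then have "stack_step M (map Sym (map Some (a # y)) @ Lift # p, Conv # g)
      (map Sym (map Some y) @ Lift # p, Conv # Push a # g)"
    using stack_step.intros[OF tm_rules.conv_sym, of a M "map Sym (map Some y) @ Lift # p" g] by simp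
  then show ?case
    using Cons.IH[of "Push a # g"] Cons.prems by (auto intro: converse_rtranclp_into_rtranclp)
qed

lemma Cons_map_Letter:
  fixes M :: "('a, 'q) turing_machine"
  assumes "set x \<subseteq> alphabet M"
  obtains c :: "('a, 'q) tm_con" and cs where "map Letter x @ [Empty] = c # cs" "c \<in> insert Empty (Letter ` alphabet M)"
  using assms by (cases x) auto

lemma stack_step_push:
  fixes M :: "('a, 'q) turing_machine"
  assumes "set y \<subseteq> alphabet M" "set x \<subseteq> alphabet M"
  shows "(stack_step M)\<^sup>*\<^sup>* (map Letter x @ [Empty], map Push y) (map Letter (rev y @ x) @ [Empty], [])"
  using assms
proof (induction y arbitrary: x)
  case Nil
  show ?case
    by simp
next
  case (Cons a y)
  obtain c :: "('a, 'q) tm_con" and cs where c: "map Letter x @ [Empty] = c # cs" "c \<in> insert Empty (Letter ` alphabet M)"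
    using Cons_map_Letter[OF Cons.prems(2)] .
  have "stack_step M (map Letter x @ [Empty], map Push (a # y)) (map Letter (a # x) @ [Empty], map Push y)"
    using stack_step.intros[OF tm_rules.push[OF c(2)], of a cs "map Push y"] c(1) Cons.prems by simp
  then show ?case
    using Cons.IH[of "a # x"] Cons.prems by (auto intro: converse_rtranclp_into_rtranclp)
qed

lemma stack_step_halt:
  fixes M :: "('a, 'q) turing_machine"
  assumes "represents M (final M, a, v, map Some w) s"
  shows "(stack_step M)\<^sup>*\<^sup>* s (map Letter w @ [Empty], [])"
  using assms
proof cases
  case (1 y x)
  note w = 1(1) and s = 1(2) and valid = 1(4-)
  let ?z = "map Letter x @ [Empty] :: ('a, 'q) tm_con list"
  \<comment> \<open>The right part of the final tape consists of letters, so no blank occurs among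
    the visited symbols. The remaining \<open>x\<close> is input never visited and already has the
    form of a word.\<close>
  obtain y' where y: "y = map Some y'" "w = y' @ x"
    using w by (auto simp: map_eq_append_conv inj_map_eq_map)
  have y': "set y' \<subseteq> alphabet M"
    using valid y by (auto simp: ext_alphabet_def)
  obtain d :: "('a, 'q) tm_con" and ds where d: "map Sym y @ Lift # ?z = d # ds" "d \<in> insert Lift (Sym ` ext_alphabet M)"
    using Cons_map_Lift[of y M] valid by blast
  have "stack_step M s (Erase # map Sym y @ Lift # ?z, map Left v @ [End])"
    using stack_step.intros[OF tm_rules.halt[OF _ d(2)], of a ds "map Left v @ [End]"] d(1) valid
    by (simp add: s)
  also have "(stack_step M)\<^sup>*\<^sup>* \<dots> (map Sym y @ Lift # ?z, [Conv])"
    using stack_step_erase valid by blast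
  also have "(stack_step M)\<^sup>*\<^sup>* \<dots> (?z, map Push (rev y'))"
    using stack_step_conv[OF y', of ?z "[]"] by (simp add: y)
  also have "(stack_step M)\<^sup>*\<^sup>* \<dots> (map Letter w @ [Empty], [])"
    using stack_step_push[of "rev y'" M x] y' valid by (simp add: y)
  finally show ?thesis .
qed

lemma stack_step_run:
  fixes M :: "('a, 'q) turing_machine"
  assumes "turing_machine M" "tm_computes M f" "x \<in> lists (alphabet M)"
  shows "(stack_step M)\<^sup>*\<^sup>* (map Letter x @ [Empty], [Start]) (map Letter (f x) @ [Empty], [])"
proof -
  let ?s = "(Lift # map Letter x @ [Empty], [Head (init M) None, End])"
  have x: "set x \<subseteq> alphabet M"
    using assms(3) by auto
  obtain c :: "('a, 'q) tm_con" and cs where c: "map Letter x @ [Empty] = c # cs" "c \<in> insert Empty (Letter ` alphabet M)"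
    using Cons_map_Letter[OF x] .
  obtain a v where run: "(tm_step M)\<^sup>*\<^sup>* (init M, None, [], map Some x) (final M, a, v, map Some (f x))"
    using assms(2,3) unfolding tm_computes_def by blast
  have "represents M (init M, None, [], map Some x) ?s"
    using represents.intros[of "init M" M None "[]" "[]" x] assms(1) x
    by (simp add: turing_machine_def ext_alphabet_def)
  then obtain s' where s': "represents M (final M, a, v, map Some (f x)) s'" "(stack_step M)\<^sup>*\<^sup>* ?s s'"
    using stack_step_tm_steps[OF run assms(1)] by blast
  have "stack_step M (map Letter x @ [Empty], [Start]) ?s"
    using stack_step.intros[OF tm_rules.start[OF c(2)], of cs "[]"] c(1) by simp
  also note s'(2)
  also note stack_step_halt[OF s'(1)]
  finally show ?thesis .
qed


section \<open>The program of a Turing machine\<close>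

lemma cells_polygraph_of [simp]:
  "cells1 (polygraph_of P) = sorts P"
  "src2 (polygraph_of P) = prog_src2 P" "tgt2 (polygraph_of P) = prog_tgt2 P"
  "src3 (polygraph_of P) = prog_src3 P" "tgt3 (polygraph_of P) = prog_tgt3 P"
  "Tau \<xi> \<zeta> \<in> cells2 (polygraph_of P) \<longleftrightarrow> \<xi> \<in> sorts P \<and> \<zeta> \<in> sorts P"
  "Delta \<xi> \<in> cells2 (polygraph_of P) \<longleftrightarrow> \<xi> \<in> sorts P"
  "Eps \<xi> \<in> cells2 (polygraph_of P) \<longleftrightarrow> \<xi> \<in> sorts P"
  "Con c \<in> cells2 (polygraph_of P) \<longleftrightarrow> c \<in> con_cells P"
  "Fun f \<in> cells2 (polygraph_of P) \<longleftrightarrow> f \<in> fun_cells P"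
  "ConTau c \<zeta> \<in> cells3 (polygraph_of P) \<longleftrightarrow> c \<in> con_cells P \<and> \<zeta> \<in> sorts P"
  "TauCon \<zeta> c \<in> cells3 (polygraph_of P) \<longleftrightarrow> c \<in> con_cells P \<and> \<zeta> \<in> sorts P"
  "ConDelta c \<in> cells3 (polygraph_of P) \<longleftrightarrow> c \<in> con_cells P"
  "ConEps c \<in> cells3 (polygraph_of P) \<longleftrightarrow> c \<in> con_cells P"
  "Comput k \<in> cells3 (polygraph_of P) \<longleftrightarrow> k \<in> computations P"
  by (auto simp: polygraph_of_def)

lemma finite_cells_polygraph_of:
  assumes "finite (sorts P)" "finite (con_cells P)" "finite (fun_cells P)" "finite (computations P)"
  shows "finite (cells2 (polygraph_of P))" "finite (cells3 (polygraph_of P))"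
  using assms by (simp_all add: polygraph_of_def finite_image_set2)

lemma polygraph3_polygraph_of:
  assumes con: "\<And>c. c \<in> con_cells P \<Longrightarrow> con_src P c \<in> lists (sorts P) \<and> con_tgt P c \<in> sorts P"
    and "fun": "\<And>f. f \<in> fun_cells P \<Longrightarrow> fun_src P f \<in> lists (sorts P) \<and> fun_tgt P f \<in> lists (sorts P)"
    and comp: "\<And>k. k \<in> computations P \<Longrightarrow>
      wf2 (polygraph_of P) (comp_src P k) \<and> wf2 (polygraph_of P) (comp_tgt P k) \<and>
      s\<^sub>1 (polygraph_of P) (comp_src P k) = s\<^sub>1 (polygraph_of P) (comp_tgt P k) \<and>
      t\<^sub>1 (polygraph_of P) (comp_src P k) = t\<^sub>1 (polygraph_of P) (comp_tgt P k)"
  shows "polygraph3 (polygraph_of P)"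
  unfolding polygraph3_def
proof (intro conjI ballI)
  fix c assume "c \<in> cells2 (polygraph_of P)"
  then show "src2 (polygraph_of P) c \<in> lists (cells1 (polygraph_of P))"
    "tgt2 (polygraph_of P) c \<in> lists (cells1 (polygraph_of P))"
    using con "fun" by (cases c; simp)+
next
  have words: "wf2 (polygraph_of P) (delta_word (con_src P c))" "wf2 (polygraph_of P) (eps_word (con_src P c))"
    if "c \<in> con_cells P" for c
    \<comment> \<open>The target of \<open>c\<close> provides the sort required by
      \<open>structure_term_wf2\<close>.\<close>
    using structure_term_wf2(3,4)[of "con_src P c" P "con_tgt P c"] con[OF that] by blast+
  fix k assume "k \<in> cells3 (polygraph_of P)"
  then have "wf2 (polygraph_of P) (prog_src3 P k) \<and> wf2 (polygraph_of P) (prog_tgt3 P k) \<and>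
    s\<^sub>1 (polygraph_of P) (prog_src3 P k) = s\<^sub>1 (polygraph_of P) (prog_tgt3 P k) \<and>
    t\<^sub>1 (polygraph_of P) (prog_src3 P k) = t\<^sub>1 (polygraph_of P) (prog_tgt3 P k)"
    using con comp
    by (cases k) (simp_all add: words structure_term_wf2(1,2) tau_left_boundary tau_right_boundary
      delta_word_boundary eps_word_boundary)
  then show "wf2 (polygraph_of P) (src3 (polygraph_of P) k)"
    "wf2 (polygraph_of P) (tgt3 (polygraph_of P) k)"
    "s\<^sub>1 (polygraph_of P) (src3 (polygraph_of P) k) = s\<^sub>1 (polygraph_of P) (tgt3 (polygraph_of P) k)"
    "t\<^sub>1 (polygraph_of P) (src3 (polygraph_of P) k) = t\<^sub>1 (polygraph_of P) (tgt3 (polygraph_of P) k)"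
    by simp_all
qed

text \<open>The sorts are 0 for words over the alphabet and 1 for tapes.\<close>

fun con_dom :: "('a, 'q) tm_con \<Rightarrow> nat list" where
  "con_dom Empty = []"
| "con_dom (Letter a) = [0]"
| "con_dom Lift = [0]"
| "con_dom c = [1]"

fun con_cod :: "('a, 'q) tm_con \<Rightarrow> nat" where
  "con_cod Empty = 0"
| "con_cod (Letter a) = 0"
| "con_cod c = 1"

fun fun_dom :: "('a, 'q) tm_fun \<Rightarrow> nat list" where
  "fun_dom Start = [0]"
| "fun_dom (Push a) = [0]"
| "fun_dom f = [1]"

text \<open>\<open>End\<close> and \<open>Conv\<close> go from tapes to words, so the strand keeps
  the sort 0 as its target throughout the run.\<close>

fun fun_cod :: "('a, 'q) tm_fun \<Rightarrow> nat list" where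
  "fun_cod (Head q a) = [1]"
| "fun_cod (Left b) = [1]"
| "fun_cod f = [0]"

lemma con_sorts: "set (con_dom c) \<subseteq> {0, 1}" "con_cod c \<in> {0, 1}" "length (con_dom c) \<le> 1"
  by (cases c; simp)+

lemma fun_sorts: "set (fun_dom f) \<subseteq> {0, 1}" "set (fun_cod f) \<subseteq> {0, 1}"
  "length (fun_dom f) = 1" "length (fun_cod f) = 1"
  by (cases f; simp)+

type_synonym ('a, 'q) tm_cell = "(nat, ('a, 'q) tm_con, ('a, 'q) tm_fun) cell2"

text \<open>Stack strings contain no structure 2-cells; the last clause is a mere default.\<close>

fun cell_dom :: "('a, 'q) tm_cell \<Rightarrow> nat list" where
  "cell_dom (Con c) = con_dom c"
| "cell_dom (Fun f) = fun_dom f"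
| "cell_dom _ = []"

fun cell_cod :: "('a, 'q) tm_cell \<Rightarrow> nat list" where
  "cell_cod (Con c) = [con_cod c]"
| "cell_cod (Fun f) = fun_cod f"
| "cell_cod _ = []"

text \<open>Reversing the constructor stack brings the tops of both stacks together in the
  middle.\<close>

definition stack_string :: "('a, 'q) stack \<Rightarrow> ('a, 'q) tm_cell list" where
  "stack_string = (\<lambda>(cs, fs). rev (map Con cs) @ map Fun fs)"

text \<open>The deepest constructor \<open>last l\<close> is the first 2-cell of the left-hand
  strand and so fixes the source of both sides.\<close>

lemma tm_rules_chain:
  assumes "(l, f, r, g) \<in> tm_rules M"
  shows "\<exists>v. chain cell_dom cell_cod (con_dom (last l)) (stack_string (l, [f])) v \<and>
    chain cell_dom cell_cod (con_dom (last l)) (stack_string (r, g)) v"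
  using assms by cases (auto simp: stack_string_def)

text \<open>Read backwards from the target: sort 0 is produced only by \<open>Letter\<close>, which
  asks for sort 0 again, and by \<open>Empty\<close>, which ends the string. This is where the
  second sort keeps blanks out of the values.\<close>

lemma con_word:
  assumes "chain cell_dom cell_cod [] (map Con cs) [0]" "set cs \<subseteq> tm_cons M"
  shows "\<exists>x \<in> lists (alphabet M). cs = Empty # rev (map Letter x)"
  using assms
proof (induction cs rule: rev_induct)
  case Nil
  then show ?case
    by simp
next
  case (snoc c cs)
  from snoc.prems have c: "con_cod c = 0" "c \<in> tm_cons M"
    and ch: "chain cell_dom cell_cod [] (map Con cs) (con_dom c)"
    by (auto simp: chain_append)
  from c consider "c = Empty" | a where "c = Letter a" "a \<in> alphabet M"
    by (cases c) (auto simp: tm_cons_def)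
  then show ?case
  proof cases
    case 1
    then have "cs = []"
      using ch by (cases cs rule: rev_cases) (auto simp: chain_append)
    then show ?thesis
      using 1 by (auto intro: bexI[of _ "[]"])
  next
    case 2
    then obtain x where "x \<in> lists (alphabet M)" "cs = Empty # rev (map Letter x)"
      using snoc.IH ch snoc.prems(2) by auto
    then show ?thesis
      using 2 by (auto intro!: bexI[of _ "a # x"])
  qed
qed

text \<open>A redex holds a constructor directly followed by a function 2-cell, and a stack string
  has only one such place.\<close>

lemma con_fun_string_split:
  fixes p :: "('x, 'c, 'f) cell2 list"
  assumes "p @ map Con l @ Fun f # q = map Con cs @ map Fun fs" "l \<noteq> []"
  shows "\<exists>p' q'. p = map Con p' \<and> q = map Fun q' \<and> cs = p' @ l \<and> fs = f # q'"
proof -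
  have "(p @ map Con l) @ Fun f # q = map Con cs @ map Fun fs"
    using assms(1) by simp
  from iffD1[OF append_eq_append_conv2 this]
  consider us where "(p @ map Con l) @ us = map Con cs" "Fun f # q = us @ map Fun fs"
    | us where "p @ map Con l = map Con cs @ us" "us @ Fun f # q = map Fun fs"
    by blast
  then have "p @ map Con l = map Con cs \<and> Fun f # q = map Fun fs"
  proof cases
    case (1 us)
    have "us = []"
    proof (rule ccontr)
      assume "us \<noteq> []"
      then have "Fun f \<in> set (map Con cs :: ('x, 'c, 'f) cell2 list)"
        using 1 by (cases us) (auto simp flip: 1(1))
      then show False
        by auto
    qed
    then show ?thesis
      using 1 by simp
  next
    case (2 us)
    have "us = []"
    proof (rule ccontr)
      assume "us \<noteq> []"
      then have "last us = last (map Con l)" "last us \<in> set (map Fun fs)"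
        using 2 assms(2) by (metis last_appendR list.map_disc_iff, simp flip: 2(2))
      then show False
        using assms(2) by (auto simp: last_map)
    qed
    then show ?thesis
      using 2 by simp
  qed
  then show ?thesis
    by (auto simp: map_eq_append_conv append_eq_map_conv Cons_eq_map_conv inj_map_eq_map inj_def)
qed

lemma map_inj_on_prefix:
  assumes "inj_on e A" "set cs \<subseteq> A" "set l \<subseteq> A" "map e cs = map e l @ p"
  obtains p' where "cs = l @ p'" "p = map e p'"
proof -
  obtain l' p' where "cs = l' @ p'" "map e l' = map e l" "p = map e p'"
    using assms(4) by (auto simp: map_eq_append_conv)
  moreover from this have "l' = l"
    using assms(1-3) by (auto intro!: map_inj_on[of e l' l] elim: inj_on_subset)
  ultimately show ?thesis
    using that by blast
qed

text \<open>The program is to have natural numbers as names of cells. Injectivity is required on the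
  finite sets of cells only, since the types of letters and states may be too large to
  embed.\<close>

locale tm_program =
  fixes M :: "('a, 'q) turing_machine"
    and eC :: "('a, 'q) tm_con \<Rightarrow> nat" and eF :: "('a, 'q) tm_fun \<Rightarrow> nat"
    and eR :: "('a, 'q) rule \<Rightarrow> nat"
  assumes tm: "turing_machine M"
    and inj_eC: "inj_on eC (tm_cons M)" and inj_eF: "inj_on eF (tm_funs M)"
    and inj_eR: "inj_on eR (tm_rules M)"
begin

definition code :: "('a, 'q) stack \<Rightarrow> (nat, nat, nat) cell2 list" where
  "code s = map (map_cell2 id eC eF) (stack_string s)"

definition lhs_term :: "('a, 'q) rule \<Rightarrow> (nat, nat, nat) prog_term" where
  "lhs_term = (\<lambda>(l, f, r, g). strand (con_dom (last l)) (code (l, [f])))"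

definition rhs_term :: "('a, 'q) rule \<Rightarrow> (nat, nat, nat) prog_term" where
  "rhs_term = (\<lambda>(l, f, r, g). strand (con_dom (last l)) (code (r, g)))"

definition prog :: "(nat, nat, nat, nat) program" where
  "prog =
     \<lparr> sorts = {0, 1},
       con_cells = eC ` tm_cons M,
       con_src = con_dom \<circ> inv_into (tm_cons M) eC,
       con_tgt = con_cod \<circ> inv_into (tm_cons M) eC,
       fun_cells = eF ` tm_funs M,
       fun_src = fun_dom \<circ> inv_into (tm_funs M) eF,
       fun_tgt = fun_cod \<circ> inv_into (tm_funs M) eF,
       computations = eR ` tm_rules M,
       comp_src = lhs_term \<circ> inv_into (tm_rules M) eR,
       comp_tgt = rhs_term \<circ> inv_into (tm_rules M) eR \<rparr>"

abbreviation G where "G \<equiv> polygraph_of prog"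

lemma prog_simps [simp]:
  "sorts prog = {0, 1}"
  "con_cells prog = eC ` tm_cons M" "fun_cells prog = eF ` tm_funs M"
  "computations prog = eR ` tm_rules M"
  "c \<in> tm_cons M \<Longrightarrow> con_src prog (eC c) = con_dom c"
  "c \<in> tm_cons M \<Longrightarrow> con_tgt prog (eC c) = con_cod c"
  "f \<in> tm_funs M \<Longrightarrow> fun_src prog (eF f) = fun_dom f"
  "f \<in> tm_funs M \<Longrightarrow> fun_tgt prog (eF f) = fun_cod f"
  "rule \<in> tm_rules M \<Longrightarrow> comp_src prog (eR rule) = lhs_term rule"
  "rule \<in> tm_rules M \<Longrightarrow> comp_tgt prog (eR rule) = rhs_term rule"
  using inj_eC inj_eF inj_eR by (simp_all add: prog_def)

text \<open>On valid stacks the numeric codes can be decoded.\<close>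

definition valid :: "('a, 'q) stack \<Rightarrow> bool" where
  "valid s \<longleftrightarrow> set (fst s) \<subseteq> tm_cons M \<and> set (snd s) \<subseteq> tm_funs M"

lemma code_eq: "code (cs, fs) = map Con (rev (map eC cs)) @ map Fun (map eF fs)"
  by (simp add: code_def stack_string_def rev_map)

lemma code_append: "code (l @ p, f @ q) = code (p, []) @ code (l, f) @ code ([], q)"
  by (simp add: code_eq)

lemma set_code: "valid s \<Longrightarrow> set (code s) \<subseteq> Con ` eC ` tm_cons M \<union> Fun ` eF ` tm_funs M"
  by (cases s) (auto simp: code_eq valid_def)

lemma wf2_code:
  assumes "valid s" "chain cell_dom cell_cod u (stack_string s) v" "set u \<subseteq> {0, 1}"
  shows "wf2 G (strand u (code s)) \<and> t\<^sub>1 G (strand u (code s)) = v"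
proof -
  have "chain (src2 G) (tgt2 G) u (code s) v \<longleftrightarrow> chain cell_dom cell_cod u (stack_string s) v"
    unfolding code_def using assms(1)
    by (intro chain_map) (cases s, auto simp: stack_string_def valid_def)
  moreover have "set (code s) \<subseteq> cells2 G"
    using set_code[OF assms(1)] by auto
  ultimately show ?thesis
    using assms wf2_strand[of G u "code s" v] by auto
qed

lemma valid_rule:
  assumes "(l, f, r, g) \<in> tm_rules M"
  shows "valid (l, [f])" "valid (r, g)" "l \<noteq> []"
  using tm_rules_cells[OF tm assms] by (auto simp: valid_def)

lemma wf2_rule:
  assumes "rule \<in> tm_rules M"
  shows "wf2 G (lhs_term rule) \<and> wf2 G (rhs_term rule) \<and> s\<^sub>1 G (lhs_term rule) = s\<^sub>1 G (rhs_term rule) \<and>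
    t\<^sub>1 G (lhs_term rule) = t\<^sub>1 G (rhs_term rule)"
proof -
  obtain l f r g where rule: "rule = (l, f, r, g)"
    by (cases rule) auto
  obtain v where v: "chain cell_dom cell_cod (con_dom (last l)) (stack_string (l, [f])) v"
    "chain cell_dom cell_cod (con_dom (last l)) (stack_string (r, g)) v"
    using tm_rules_chain assms rule by blast
  note valid = valid_rule[OF assms[unfolded rule]]
  show ?thesis
    using wf2_code[OF valid(1) v(1) con_sorts(1)] wf2_code[OF valid(2) v(2) con_sorts(1)]
    by (simp add: rule lhs_term_def rhs_term_def)
qed

lemma polygraph3_G: "polygraph3 G"
proof (rule polygraph3_polygraph_of)
  fix c assume "c \<in> con_cells prog"
  then obtain d where "d \<in> tm_cons M" "c = eC d"
    by auto
  then show "con_src prog c \<in> lists (sorts prog) \<and> con_tgt prog c \<in> sorts prog"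
    using con_sorts(1,2)[of d] by (simp add: lists_eq_set)
next
  fix f assume "f \<in> fun_cells prog"
  then obtain h where "h \<in> tm_funs M" "f = eF h"
    by auto
  then show "fun_src prog f \<in> lists (sorts prog) \<and> fun_tgt prog f \<in> lists (sorts prog)"
    using fun_sorts(1,2)[of h] by (simp add: lists_eq_set)
next
  fix k assume "k \<in> computations prog"
  then show "wf2 G (comp_src prog k) \<and> wf2 G (comp_tgt prog k) \<and>
      s\<^sub>1 G (comp_src prog k) = s\<^sub>1 G (comp_tgt prog k) \<and>
      t\<^sub>1 G (comp_src prog k) = t\<^sub>1 G (comp_tgt prog k)"
    using wf2_rule by auto
qed

lemma polygraphic_program_prog: "polygraphic_program prog"
  unfolding polygraphic_program_def
proof (intro conjI ballI)
  show "finite_polygraph3 G"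
    using polygraph3_G finite_cells_polygraph_of[of prog] finite_tm_cells[OF tm] finite_tm_rules[OF tm]
    by (simp add: finite_polygraph3_def)
next
  fix k assume "k \<in> computations prog"
  then obtain l f r g where rule: "(l, f, r, g) \<in> tm_rules M" and k: "k = eR (l, f, r, g)"
    by auto
  define t where "t = strand (con_dom (last l)) (code (l, []))"
  have src: "comp_src prog k = t \<star>\<^sub>1 Gen (Fun (eF f))"
    using rule by (simp add: k lhs_term_def code_eq t_def flip: strand_snoc)
  have f: "f \<in> tm_funs M"
    using valid_rule(1)[OF rule] by (simp add: valid_def)
  have "wf2 G (t \<star>\<^sub>1 Gen (Fun (eF f)))"
    using wf2_rule[OF rule] src rule by (simp add: k)
  then have "wf2 G t" "t\<^sub>1 G t = fun_src prog (eF f)"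
    by auto
  moreover have "gens t \<subseteq> Con ` con_cells prog"
    using valid_rule(1)[OF rule] by (auto simp: t_def code_eq valid_def)
  ultimately show "\<exists>t. \<exists>f \<in> fun_cells prog. constructor_term prog t \<and> t\<^sub>1 G t = fun_src prog f \<and>
      path2 G (comp_src prog k) = path2 G (t \<star>\<^sub>1 Gen (Fun f))"
    using f src by (auto simp: constructor_term_def)
qed

section \<open>Rewriting of encoded stacks\<close>

definition string_rules :: "((nat, nat, nat) cell2 list \<times> (nat, nat, nat) cell2 list) set" where
  "string_rules = (\<lambda>(l, f, r, g). (code (l, [f]), code (r, g))) ` tm_rules M"

lemma src_hd_code:
  assumes "(l, f, r, g) \<in> tm_rules M"
  shows "prog_src2 prog (hd (code (l, [f]))) = con_dom (last l)"
  using valid_rule(1,3)[OF assms] by (cases l rule: rev_cases) (auto simp: code_eq valid_def)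

sublocale string_polygraph G "Con ` eC ` tm_cons M \<union> Fun ` eF ` tm_funs M" string_rules
proof
  show "polygraph3 G"
    by (rule polygraph3_G)
next
  fix c :: "(nat, nat, nat) cell2"
  assume "c \<in> Con ` eC ` tm_cons M \<union> Fun ` eF ` tm_funs M"
  then show "length (src2 G c) \<le> 1 \<and> length (tgt2 G c) = 1"
    by (auto simp: con_sorts(3)[simplified] fun_sorts(3,4)[simplified])
next
  fix k assume k: "k \<in> cells3 G" "gens (src3 G k) \<subseteq> Con ` eC ` tm_cons M \<union> Fun ` eF ` tm_funs M"
  \<comment> \<open>Each structure 3-cell has \<open>Tau\<close>, \<open>Delta\<close> or
    \<open>Eps\<close> in its source and is thereby ruled out.\<close>
  then obtain l f r g where rule: "(l, f, r, g) \<in> tm_rules M" "k = Comput (eR (l, f, r, g))"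
    by (cases k) auto
  have "(code (l, [f]), code (r, g)) \<in> string_rules"
    using rule(1) by (force simp: string_rules_def)
  then show "\<exists>(l, r) \<in> string_rules. src3 G k = strand (src2 G (hd l)) l \<and>
      tgt3 G k = strand (src2 G (hd l)) r"
    using rule by (auto simp: src_hd_code lhs_term_def rhs_term_def intro!: bexI)
next
  fix l r assume "(l, r) \<in> string_rules"
  then obtain cs f cs' g where rule: "(cs, f, cs', g) \<in> tm_rules M" "l = code (cs, [f])" "r = code (cs', g)"
    by (auto simp: string_rules_def)
  have "\<exists>k \<in> cells3 G. src3 G k = strand (src2 G (hd l)) l \<and> tgt3 G k = strand (src2 G (hd l)) r"
    using rule by (intro bexI[of _ "Comput (eR (cs, f, cs', g))"])
      (auto simp: src_hd_code lhs_term_def rhs_term_def)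
  moreover have "l \<noteq> []"
    by (simp add: rule(2) code_eq)
  ultimately show "l \<noteq> [] \<and> set l \<subseteq> Con ` eC ` tm_cons M \<union> Fun ` eF ` tm_funs M \<and>
      set r \<subseteq> Con ` eC ` tm_cons M \<union> Fun ` eF ` tm_funs M \<and>
      (\<exists>k \<in> cells3 G. src3 G k = strand (src2 G (hd l)) l \<and> tgt3 G k = strand (src2 G (hd l)) r)"
    using set_code[OF valid_rule(1)[OF rule(1)]] set_code[OF valid_rule(2)[OF rule(1)]] rule(2,3) by simp
qed

lemma stack_step_srewrite:
  assumes "stack_step M s s'"
  shows "srewrite string_rules (code s) (code s')"
  using assms
proof cases
  case (1 l f r g p q)
  then have "(code (l, [f]), code (r, g)) \<in> string_rules"
    by (force simp: string_rules_def)
  then show ?thesis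
    using srewrite.intros[of "code (l, [f])" "code (r, g)" string_rules "code (p, [])" "code ([], q)"]
      code_append[of l p "[f]" q] code_append[of r p g q] 1 by simp
qed

lemma stack_step_valid:
  assumes "stack_step M s s'" "valid s"
  shows "valid s'"
  using assms(1)
proof cases
  case 1
  then show ?thesis
    using valid_rule(2)[OF 1(3)] assms(2) by (auto simp: valid_def)
qed

text \<open>The redex must sit where the two stacks meet, and injectivity of the codes on valid
  stacks recovers the remaining stacks from its context.\<close>

lemma srewrite_stack_step:
  assumes "srewrite string_rules (code s) y" "valid s"
  shows "\<exists>s'. stack_step M s s' \<and> y = code s'"
proof -
  obtain cs fs where s: "s = (cs, fs)"
    by (cases s)
  from assms(1) obtain l' r' p q where lr: "(l', r') \<in> string_rules"
    and eq': "code s = p @ l' @ q" "y = p @ r' @ q"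
    by (cases rule: srewrite.cases) blast
  from lr obtain l f r g where rule: "(l, f, r, g) \<in> tm_rules M"
    and l': "l' = code (l, [f])" and r': "r' = code (r, g)"
    unfolding string_rules_def by auto
  note eq = eq'(1)[unfolded l'] and y = eq'(2)[unfolded r']
  note valid = valid_rule[OF rule]
  have "p @ map Con (rev (map eC l)) @ Fun (eF f) # q = map Con (rev (map eC cs)) @ map Fun (map eF fs)"
    using eq by (simp add: s code_eq)
  moreover have "rev (map eC l) \<noteq> []"
    using valid(3) by simp
  ultimately have "\<exists>p' q'. p = map Con p' \<and> q = map Fun q' \<and> rev (map eC cs) = p' @ rev (map eC l) \<and>
      map eF fs = eF f # q'"
    by (rule con_fun_string_split)
  then obtain p' q' where p: "p = map Con p'" "rev (map eC cs) = p' @ rev (map eC l)"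
    and q: "q = map Fun q'" "map eF fs = eF f # q'"
    by (elim exE conjE) rule
  have "map eC cs = map eC l @ rev p'"
    using p(2) by (metis rev_append rev_rev_ident)
  then obtain p'' where p'': "cs = l @ p''" "rev p' = map eC p''"
    using map_inj_on_prefix[OF inj_eC, of cs l "rev p'"] assms(2) valid(1) by (auto simp: valid_def s)
  have "map eF fs = map eF [f] @ q'"
    using q(2) by simp
  then obtain q'' where q'': "fs = [f] @ q''" "q' = map eF q''"
    using map_inj_on_prefix[OF inj_eF, of fs "[f]" q'] assms(2) valid(1) by (auto simp: valid_def s)
  have "p' = rev (map eC p'')"
    using p''(2) by (metis rev_rev_ident)
  then have "y = code (r @ p'', g @ q'')"
    by (simp add: y p(1) q(1) q''(2) code_append) (simp add: code_eq)
  then show ?thesis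
    using stack_step.intros[OF rule, of p'' q''] by (auto simp: s p''(1) q''(1))
qed

lemma unique_normal_form_code:
  assumes "(stack_step M)\<^sup>*\<^sup>* s n" "valid s" "closed_string (code s)" "\<And>t. \<not> stack_step M n t"
  shows "unique_normal_form G (path2 G (strand [] (code s))) (path2 G (strand [] (code n)))"
proof (rule unique_normal_form_strand)
  have valid: "valid t" if "(stack_step M)\<^sup>*\<^sup>* s t" for t
    using that by induction (auto intro: stack_step_valid assms(2))
  show "(srewrite string_rules)\<^sup>*\<^sup>* (code s) (code n)"
    using assms(1) by induction (auto intro: stack_step_srewrite rtranclp.rtrancl_into_rtrancl)
  show "\<not> srewrite string_rules (code n) t" for t
    using srewrite_stack_step valid assms(1,4) by blast
  fix x y z
  assume "(srewrite string_rules)\<^sup>*\<^sup>* (code s) x"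
  then have "\<exists>t. x = code t \<and> (stack_step M)\<^sup>*\<^sup>* s t"
  proof induction
    case base
    show ?case
      by blast
  next
    case (step x y)
    then obtain t where t: "x = code t" "(stack_step M)\<^sup>*\<^sup>* s t"
      by blast
    then obtain t' where "stack_step M t t'" "y = code t'"
      using srewrite_stack_step valid step.hyps(2) by blast
    then show ?case
      using rtranclp.rtrancl_into_rtrancl[OF t(2)] by blast
  qed
  then obtain t where t: "x = code t" "(stack_step M)\<^sup>*\<^sup>* s t"
    by blast
  assume "srewrite string_rules x y" "srewrite string_rules x z"
  then obtain u v where "stack_step M t u" "y = code u" "stack_step M t v" "z = code v"
    using srewrite_stack_step[OF _ valid[OF t(2)]] t(1) by meson
  then show "y = z"
    using stack_step_deterministic by blast
qed (rule assms(3))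

section \<open>Words as values and the semantics of the program\<close>

definition word_code :: "'a list \<Rightarrow> (nat, nat, nat) cell2 list" where
  "word_code x = code (map Letter x @ [Empty], [])"

lemma valid_word:
  assumes "x \<in> lists (alphabet M)"
  shows "valid (map Letter x @ [Empty], [])" "valid (map Letter x @ [Empty], [Start])"
  using assms by (auto simp: valid_def tm_cons_def tm_funs_def)

lemma chain_word:
  "chain cell_dom cell_cod [] (stack_string (map Letter x @ [Empty], [])) [0]"
  by (induction x) (auto simp: stack_string_def chain_append)

lemma chain_word_Start:
  "chain cell_dom cell_cod [] (stack_string (map Letter x @ [Empty], [Start])) [0]"
  using chain_word[of x] by (auto simp: stack_string_def chain_append)

lemma wf2_word:
  assumes "x \<in> lists (alphabet M)"
  shows "wf2 G (strand [] (word_code x))" "t\<^sub>1 G (strand [] (word_code x)) = [0]"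
    "closed_string (word_code x)" "closed_string (code (map Letter x @ [Empty], [Start]))"
proof -
  show "wf2 G (strand [] (word_code x))" "t\<^sub>1 G (strand [] (word_code x)) = [0]"
    using wf2_code[OF valid_word(1)[OF assms] chain_word] by (auto simp: word_code_def)
  then show "closed_string (word_code x)"
    unfolding closed_string_def word_code_def
    using set_code[OF valid_word(1)[OF assms]] by (auto simp: code_eq)
  show "closed_string (code (map Letter x @ [Empty], [Start]))"
    unfolding closed_string_def
    using wf2_code[OF valid_word(2)[OF assms] chain_word_Start] set_code[OF valid_word(2)[OF assms]]
    by (auto simp: code_eq)
qed

lemma word_val_prog:
  assumes "x \<in> lists (alphabet M)"
  shows "word_val prog (eC Empty) (eC \<circ> Letter) x = path2 G (strand [] (word_code x))"
  using assms
proof (induction x rule: list.induct)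
  case Nil
  have wf: "wf2 G (strand [] (word_code []))"
    using wf2_word(1)[of "[]"] by simp
  have nil: "strand [] (word_code []) = Ident [] \<star>\<^sub>1 Gen (Con (eC Empty))"
    by (simp add: word_code_def code_eq)
  have "eq2 G (strand [] (word_code [])) (Gen (Con (eC Empty)))"
    using wf eq2_unit1_left[of G "Gen (Con (eC Empty))"] by (simp add: nil tm_cons_def)
  then show ?case
    by (simp add: cell_path_def flip: path2_eq_iff[OF wf])
next
  case (Cons a x)
  have snoc: "strand [] (word_code (a # x)) = strand [] (word_code x) \<star>\<^sub>1 Gen (Con (eC (Letter a)))"
    by (simp add: word_code_def code_eq flip: strand_snoc)
  have "wf2 G (strand [] (word_code x) \<star>\<^sub>1 Gen (Con (eC (Letter a))))"
    using wf2_word(1)[OF Cons.prems] by (simp add: snoc)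
  from comp1_path2[OF polygraph3_G this] show ?case
    using Cons by (simp add: cell_path_def snoc)
qed

lemma word_code_inject:
  assumes "x \<in> lists (alphabet M)" "y \<in> lists (alphabet M)" "word_code x = word_code y"
  shows "x = y"
proof -
  have "map eC (map Letter x) = map eC (map Letter y)"
    using assms(3) by (auto simp: word_code_def code_eq inj_map_eq_map inj_def)
  then have "map Letter x = (map Letter y :: ('a, 'q) tm_con list)"
    using assms(1,2) inj_eC
    by (intro map_inj_on[of eC]) (auto simp: tm_cons_def elim!: inj_on_subset)
  then show ?thesis
    by (simp add: inj_map_eq_map inj_def)
qed

text \<open>Constructors have arity at most 1, so a value of sort 0 is a single strand, and typing
  then forces \<open>Empty\<close> followed by letters.\<close>

lemma vals_prog: "vals prog [0] = (\<lambda>x. path2 G (strand [] (word_code x))) ` lists (alphabet M)"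
proof (intro set_eqI iffI)
  fix X assume "X \<in> vals prog [0]"
  then obtain t where t: "constructor_term prog t" "s\<^sub>1 G t = []" "t\<^sub>1 G t = [0]" "X = path2 G t"
    by (auto simp: vals_def)
  then have wf: "wf2 G t" "gens t \<subseteq> Con ` eC ` tm_cons M"
    by (auto simp: constructor_term_def)
  have "length (t\<^sub>1 G t) = 1"
    using t(3) by simp
  from closed_term_strand[OF wf(1) le_supI1[OF wf(2)] t(2) this]
  obtain s where s: "eq2 G t (strand [] s)" .
  have "set s \<subseteq> (\<lambda>c. Con (eC c)) ` tm_cons M"
    using eq2_gens[OF s] wf(2) by auto
  then have "s \<in> map (\<lambda>c. Con (eC c)) ` lists (tm_cons M)"
    unfolding lists_image[symmetric] by auto
  then obtain cs where cs: "set cs \<subseteq> tm_cons M" "s = map (\<lambda>c. Con (eC c)) cs"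
    by auto
  have "chain (src2 G) (tgt2 G) [] s [0]"
    using eq2_wf_boundary[OF polygraph3_G s] t(3) wf2_strand[of G "[]" s "[0]"] by simp
  moreover have "s = map (map_cell2 id eC eF) (map Con cs)"
    by (simp add: cs(2))
  moreover have "chain (src2 G) (tgt2 G) [] (map (map_cell2 id eC eF) (map Con cs)) [0] \<longleftrightarrow>
      chain cell_dom cell_cod [] (map Con cs) [0]"
    using cs(1) by (intro chain_map) auto
  ultimately have "chain cell_dom cell_cod [] (map Con cs) [0]"
    by simp
  then obtain x where x: "x \<in> lists (alphabet M)" "cs = Empty # rev (map Letter x)"
    using con_word cs(1) by blast
  have "s = word_code x"
    by (simp add: cs(2) x(2) word_code_def code_eq rev_map)
  then show "X \<in> (\<lambda>x. path2 G (strand [] (word_code x))) ` lists (alphabet M)"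
    using x(1) t(4) s wf(1) path2_eq_iff by blast
next
  fix X assume "X \<in> (\<lambda>x. path2 G (strand [] (word_code x))) ` lists (alphabet M)"
  then obtain x where x: "x \<in> lists (alphabet M)" "X = path2 G (strand [] (word_code x))"
    by blast
  then have "constructor_term prog (strand [] (word_code x))"
    using wf2_word(1)[OF x(1)] valid_word(1)[OF x(1)]
    by (auto simp: constructor_term_def word_code_def code_eq valid_def)
  then show "X \<in> vals prog [0]"
    using x wf2_word(2) by (auto simp: vals_def)
qed

lemma bij_betw_word_val:
  "bij_betw (word_val prog (eC Empty) (eC \<circ> Letter)) (lists (alphabet M)) (vals prog [0])"
  unfolding bij_betw_def
proof
  show "inj_on (word_val prog (eC Empty) (eC \<circ> Letter)) (lists (alphabet M))"
    using word_code_inject path2_strand_inject wf2_word(3) by (auto simp: inj_on_def word_val_prog)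
  show "word_val prog (eC Empty) (eC \<circ> Letter) ` lists (alphabet M) = vals prog [0]"
    by (auto simp: vals_prog word_val_prog)
qed

lemma word_normal: "\<not> stack_step M (cs, []) t"
  by (auto elim: stack_step.cases)

text \<open>The run ends in a stack without function 2-cells, which is normal because every rule
  consumes one.\<close>

lemma sem_prog:
  assumes "tm_computes M f" "x \<in> lists (alphabet M)" "f x \<in> lists (alphabet M)"
  shows "sem prog (cell_path prog (Fun (eF Start))) (word_val prog (eC Empty) (eC \<circ> Letter) x) =
    Some (word_val prog (eC Empty) (eC \<circ> Letter) (f x))"
proof -
  let ?X = "cell_path prog (Fun (eF Start))"
  have F: "Start \<in> tm_funs M"
    by (simp add: tm_funs_def)
  then have bd: "src_path G ?X = [0]" "tgt_path G ?X = [0]"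
    using polygraph3_G by (simp_all add: cell_path_def src_path_path2 tgt_path_path2)
  have snoc: "strand [] (code (map Letter x @ [Empty], [Start])) =
      strand [] (word_code x) \<star>\<^sub>1 Gen (Fun (eF Start))"
    by (simp add: word_code_def code_eq flip: strand_snoc)
  have "wf2 G (strand [] (word_code x) \<star>\<^sub>1 Gen (Fun (eF Start)))"
    using wf2_word(4)[OF assms(2)] by (simp add: closed_string_def snoc)
  from comp1_path2[OF polygraph3_G this]
  have comp: "comp1 G (path2 G (strand [] (word_code x))) ?X =
      path2 G (strand [] (code (map Letter x @ [Empty], [Start])))"
    by (simp add: cell_path_def snoc)
  have nf: "unique_normal_form G (comp1 G (path2 G (strand [] (word_code x))) ?X)
      (path2 G (strand [] (word_code (f x))))"
    unfolding comp unfolding word_code_def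
    using stack_step_run[OF tm assms(1,2)] valid_word(2) wf2_word(4) assms(2) word_normal
    by (intro unique_normal_form_code) auto
  then have "(THE t. unique_normal_form G (comp1 G (path2 G (strand [] (word_code x))) ?X) t) =
      path2 G (strand [] (word_code (f x)))"
    by (auto simp: unique_normal_form_def)
  then show ?thesis
    using nf assms(2,3) by (auto simp: sem_def Let_def bd vals_prog word_val_prog)
qed

end

theorem theorem1p30:
  fixes M :: "('a, 'q) turing_machine" and f :: "'a list \<Rightarrow> 'a list"
  assumes "turing_machine M"
    and "f \<in> lists (alphabet M) \<rightarrow> lists (alphabet M)"
    and "tm_computes M f"
  shows "\<exists>(P :: (nat, nat, nat, nat) program) w nil letter F.
    polygraphic_program P \<and>
    w \<in> sorts P \<and>
    nil \<in> con_cells P \<and> con_src P nil = [] \<and> con_tgt P nil = w \<and>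
    inj_on letter (alphabet M) \<and>
    (\<forall>a \<in> alphabet M.
       letter a \<in> con_cells P \<and> con_src P (letter a) = [w] \<and> con_tgt P (letter a) = w) \<and>
    F \<in> fun_cells P \<and> fun_src P F = [w] \<and> fun_tgt P F = [w] \<and>
    bij_betw (word_val P nil letter) (lists (alphabet M)) (vals P [w]) \<and>
    (\<forall>x \<in> lists (alphabet M).
       sem P (cell_path P (Fun F)) (word_val P nil letter x) = Some (word_val P nil letter (f x)))"
proof -
  obtain eC :: "('a, 'q) tm_con \<Rightarrow> nat" where eC: "inj_on eC (tm_cons M)"
    using finite_imp_inj_to_nat_seg[OF finite_tm_cells(1)[OF assms(1)]] by blast
  obtain eF :: "('a, 'q) tm_fun \<Rightarrow> nat" where eF: "inj_on eF (tm_funs M)"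
    using finite_imp_inj_to_nat_seg[OF finite_tm_cells(2)[OF assms(1)]] by blast
  obtain eR :: "('a, 'q) rule \<Rightarrow> nat" where eR: "inj_on eR (tm_rules M)"
    using finite_imp_inj_to_nat_seg[OF finite_tm_rules[OF assms(1)]] by blast
  interpret tm_program M eC eF eR
    by unfold_locales (fact assms(1) eC eF eR)+
  have cells: "Empty \<in> tm_cons M" "Start \<in> tm_funs M" "\<And>a. a \<in> alphabet M \<Longrightarrow> Letter a \<in> tm_cons M"
    by (auto simp: tm_cons_def tm_funs_def)
  have "inj_on (eC \<circ> Letter) (alphabet M)"
    using cells(3) by (intro comp_inj_on inj_on_subset[OF eC]) (auto simp: inj_on_def)
  then show ?thesis
    using cells polygraphic_program_prog bij_betw_word_val sem_prog[OF assms(3)] assms(2)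
    by (intro exI[of _ prog] exI[of _ "0 :: nat"] exI[of _ "eC Empty"] exI[of _ "eC \<circ> Letter"]
        exI[of _ "eF Start"]) auto
qed

end
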